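(* Let $\sigma_0>0$, $\alpha_0\in\mathbb{R}$, and let $$\mathcal{H}(\xi,\chi)=\frac12\int_{\mathbb{T}^1}\chi\,G(\xi)\chi\,d\theta+\sigma_0\int_{\mathbb{T}^1}e^{\xi}\sqrt{1+\xi'^2}\,d\theta-\Big(\sigma_0-\frac{\alpha_0^2}{8}\Big)\frac12\int_{\mathbb{T}^1}e^{2\xi}\,d\theta-\frac{\alpha_0}{4}\int_{\mathbb{T}^1}e^{2\xi}\chi'\,d\theta+\frac{\alpha_0^2}{32}\int_{\mathbb{T}^1}e^{4\xi}\,d\theta.$$ The equations $$\partial_t\begin{pmatrix}\xi\\\chi\end{pmatrix}=J_{\alpha_0}(\xi)\nabla\mathcal{H}(\xi,\chi),\qquad J_{\alpha_0}(\xi)=\begin{pmatrix}0&e^{-2\xi}\\-e^{-2\xi}&\alpha_0\partial_\theta^{-1}\Pi_0^\perp\end{pmatrix},$$ are equivalent to the Hamiltonian equations $$\partial_t\begin{pmatrix}\zeta\\\gamma\end{pmatrix}=J(\zeta)\nabla\bar{\mathcal{H}}(\zeta,\gamma),\qquad J(\zeta):=\begin{pmatrix}0&e^{-2\zeta}\\-e^{-2\zeta}&0\end{pmatrix},$$ where $$\begin{pmatrix}\xi\\\chi\end{pmatrix}=\mathcal{C}(\zeta,\gamma):=\begin{pmatrix}\zeta\\\gamma+\frac{\alpha_0}{4}\partial_\theta^{-1}\Pi_0^\perp e^{2\zeta}\end{pmatrix},\qquad\bar{\mathcal{H}}:=\mathcal{H}\circ\mathcal{C}.$$ That is, $(\xi,\chi)=\mathcal{C}(\zeta,\gamma)$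 solves the first system if and only if $(\zeta,\gamma)$ solves the second.
   Context: $\mathbb{T}^1=\mathbb{R}/2\pi\mathbb{Z}$; prime is $\partial_\theta$; all functions are smooth enough for classical solutions. $\nabla$ denotes the $L^2(\mathbb{T}^1)\times L^2(\mathbb{T}^1)$ gradient. $\Pi_0^\perp$ is the $L^2$-projector onto zero-average functions, $\partial_\theta^{-1}$ the indefinite integral operator on zero-average functions (with zero-average output). $G(\xi)\chi$ is the infinite-depth Dirichlet–Neumann operator: $G(\xi)\chi(\theta)=(\partial_\rho\tilde\Phi-\xi'\partial_\theta\tilde\Phi)(\xi(\theta),\theta)$, where $\tilde\Phi$ is harmonic in $\{(\rho,\theta):\theta\in\mathbb{T}^1,\rho<\xi(\theta)\}$, $\tilde\Phi(\xi(\theta),\theta)=\chi(\theta)$, and $\partial_\rho\tilde\Phi\to0$ as $\rho\to-\infty$. *)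

theory Defs
  imports "HOL-Analysis.Analysis"
begin

text \<open>Functions on the circle are represented by \<open>2\<pi>\<close>-periodic functions on \<^typ>\<open>real\<close>.\<close>

definition circle_int :: "(real \<Rightarrow> real) \<Rightarrow> real" where
  "circle_int f = (LBINT \<theta>=0..2*pi. f \<theta>)"

definition circle_Ck :: "nat \<Rightarrow> (real \<Rightarrow> real) set" where
  "circle_Ck k = {f. (\<forall>\<theta>. f (\<theta> + 2*pi) = f \<theta>) \<and>
                     (\<forall>j<k. (deriv ^^ j) f differentiable_on UNIV) \<and>
                     continuous_on UNIV ((deriv ^^ k) f)}"

definition Ck_norm :: "nat \<Rightarrow> (real \<Rightarrow> real) \<Rightarrow> real" where
  "Ck_norm k f = (\<Sum>j\<le>k. SUP \<theta>. \<bar>(deriv ^^ j) f \<theta>\<bar>)"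

definition Pi0_perp :: "(real \<Rightarrow> real) \<Rightarrow> real \<Rightarrow> real" where
  "Pi0_perp f = (\<lambda>\<theta>. f \<theta> - circle_int f / (2*pi))"

text \<open>The zero-average primitive, to be applied to zero-average functions. The integral is
  oriented, so that negative \<open>\<theta>\<close> is covered.\<close>

definition d_inv :: "(real \<Rightarrow> real) \<Rightarrow> real \<Rightarrow> real" where
  "d_inv f = Pi0_perp (\<lambda>\<theta>. LBINT s=0..\<theta>. f s)"

subsection \<open>The Dirichlet--Neumann operator\<close>

text \<open>Points of the plane are written \<open>(\<rho>, \<theta>)\<close>, and the Laplacian is the flat one in these
  coordinates.\<close>

definition d_rho :: "(real \<times> real \<Rightarrow> real) \<Rightarrow> real \<times> real \<Rightarrow> real" where
  "d_rho f = (\<lambda>(\<rho>, \<theta>). deriv (\<lambda>r. f (r, \<theta>)) \<rho>)"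

definition d_theta :: "(real \<times> real \<Rightarrow> real) \<Rightarrow> real \<times> real \<Rightarrow> real" where
  "d_theta f = (\<lambda>(\<rho>, \<theta>). deriv (\<lambda>s. f (\<rho>, s)) \<theta>)"

definition C1_on :: "(real \<times> real) set \<Rightarrow> (real \<times> real \<Rightarrow> real) \<Rightarrow> bool" where
  "C1_on U f \<longleftrightarrow> f differentiable_on U \<and> continuous_on U (d_rho f) \<and> continuous_on U (d_theta f)"

definition harmonic_on :: "(real \<times> real) set \<Rightarrow> (real \<times> real \<Rightarrow> real) \<Rightarrow> bool" where
  "harmonic_on U f \<longleftrightarrow> C1_on U f \<and> C1_on U (d_rho f) \<and> C1_on U (d_theta f) \<and>
     (\<forall>p\<in>U. d_rho (d_rho f) p + d_theta (d_theta f) p = 0)"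

definition fluid_domain :: "(real \<Rightarrow> real) \<Rightarrow> (real \<times> real) set" where
  "fluid_domain \<xi> = {(\<rho>, \<theta>). \<rho> < \<xi> \<theta>}"

definition closed_fluid_domain :: "(real \<Rightarrow> real) \<Rightarrow> (real \<times> real) set" where
  "closed_fluid_domain \<xi> = {(\<rho>, \<theta>). \<rho> \<le> \<xi> \<theta>}"

definition harmonic_extension ::
    "(real \<Rightarrow> real) \<Rightarrow> (real \<Rightarrow> real) \<Rightarrow> (real \<times> real \<Rightarrow> real) \<Rightarrow> bool" where
  "harmonic_extension \<xi> chi \<Phi> \<longleftrightarrow>
     (\<forall>\<rho> \<theta>. \<rho> \<le> \<xi> \<theta> \<longrightarrow> \<Phi> (\<rho>, \<theta> + 2*pi) = \<Phi> (\<rho>, \<theta>)) \<and>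
     harmonic_on (fluid_domain \<xi>) \<Phi> \<and>
     continuous_on (closed_fluid_domain \<xi>) \<Phi> \<and>
     (\<forall>\<theta>. \<Phi> (\<xi> \<theta>, \<theta>) = chi \<theta>) \<and>
     uniform_limit UNIV (\<lambda>\<rho> \<theta>. d_rho \<Phi> (\<rho>, \<theta>)) (\<lambda>_. 0) at_bot"

text \<open>\<open>P\<close> and \<open>Q\<close> are the continuous extensions of \<open>\<partial>\<^sub>\<rho>\<Phi>\<close> and \<open>\<partial>\<^sub>\<theta>\<Phi>\<close> up to the free surface; they
  give the meaning of these derivatives at surface points, where \<open>\<Phi>\<close> is only known on one side.\<close>

definition DN :: "(real \<Rightarrow> real) \<Rightarrow> (real \<Rightarrow> real) \<Rightarrow> real \<Rightarrow> real" where
  "DN \<xi> chi = (THE g. \<exists>\<Phi> P Q. harmonic_extension \<xi> chi \<Phi> \<and>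
     continuous_on (closed_fluid_domain \<xi>) P \<and> continuous_on (closed_fluid_domain \<xi>) Q \<and>
     (\<forall>p\<in>fluid_domain \<xi>. P p = d_rho \<Phi> p \<and> Q p = d_theta \<Phi> p) \<and>
     g = (\<lambda>\<theta>. P (\<xi> \<theta>, \<theta>) - deriv \<xi> \<theta> * Q (\<xi> \<theta>, \<theta>)))"

subsection \<open>Gradients and Hamiltonian systems\<close>

type_synonym state = "(real \<Rightarrow> real) \<times> (real \<Rightarrow> real)"

text \<open>The pair \<open>(g\<^sub>1, g\<^sub>2)\<close> represents, with respect to the \<open>L\<^sup>2\<close> scalar product, the (Frechet)
  differential at \<open>(u, v)\<close> of a functional on the product of two copies of the Banach space
  \<^term>\<open>circle_Ck k\<close>. A continuous representative is unique.\<close>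

definition has_L2_gradient :: "nat \<Rightarrow> (state \<Rightarrow> real) \<Rightarrow> state \<Rightarrow> state \<Rightarrow> bool" where
  "has_L2_gradient k F = (\<lambda>(u, v) (g\<^sub>1, g\<^sub>2).
     g\<^sub>1 \<in> circle_Ck 0 \<and> g\<^sub>2 \<in> circle_Ck 0 \<and>
     (\<forall>\<epsilon>>0. \<exists>\<delta>>0. \<forall>h\<in>circle_Ck k. \<forall>w\<in>circle_Ck k. Ck_norm k h + Ck_norm k w < \<delta> \<longrightarrow>
        \<bar>F (\<lambda>\<theta>. u \<theta> + h \<theta>, \<lambda>\<theta>. v \<theta> + w \<theta>) - F (u, v)
           - circle_int (\<lambda>\<theta>. g\<^sub>1 \<theta> * h \<theta> + g\<^sub>2 \<theta> * w \<theta>)\<bar>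
        \<le> \<epsilon> * (Ck_norm k h + Ck_norm k w)))"

text \<open>Classical solutions on the time interval \<open>T\<close> of \<open>\<partial>\<^sub>t x = J(x\<^sub>1) \<nabla>F(x)\<close>, where \<open>x\<^sub>1\<close> is the
  first component of \<open>x\<close>: at each time the state is of class \<open>C\<^sup>k\<close>, the time derivatives \<open>a\<close>, \<open>b\<close>
  of the two components are jointly continuous, and the equations hold pointwise.\<close>

definition classical_solution ::
    "nat \<Rightarrow> real set \<Rightarrow> ((real \<Rightarrow> real) \<Rightarrow> state \<Rightarrow> state) \<Rightarrow> (state \<Rightarrow> real) \<Rightarrow>
     (real \<Rightarrow> state) \<Rightarrow> bool" where
  "classical_solution k T J F x \<longleftrightarrow>
     (\<forall>t\<in>T. fst (x t) \<in> circle_Ck k \<and> snd (x t) \<in> circle_Ck k) \<and>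
     (\<exists>a b :: real \<Rightarrow> real \<Rightarrow> real.
        continuous_on (T \<times> UNIV) (\<lambda>(t, \<theta>). a t \<theta>) \<and>
        continuous_on (T \<times> UNIV) (\<lambda>(t, \<theta>). b t \<theta>) \<and>
        (\<forall>t\<in>T. \<forall>\<theta>.
           ((\<lambda>s. fst (x s) \<theta>) has_real_derivative a t \<theta>) (at t within T) \<and>
           ((\<lambda>s. snd (x s) \<theta>) has_real_derivative b t \<theta>) (at t within T)) \<and>
        (\<forall>t\<in>T. \<exists>g. has_L2_gradient k F (x t) g \<and> (a t, b t) = J (fst (x t)) g))"

subsection \<open>The two Hamiltonian formulations\<close>

definition Ham :: "real \<Rightarrow> real \<Rightarrow> state \<Rightarrow> real" where
  "Ham \<sigma>\<^sub>0 \<alpha>\<^sub>0 = (\<lambda>(\<xi>, chi).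
     1/2 * circle_int (\<lambda>\<theta>. chi \<theta> * DN \<xi> chi \<theta>)
     + \<sigma>\<^sub>0 * circle_int (\<lambda>\<theta>. exp (\<xi> \<theta>) * sqrt (1 + (deriv \<xi> \<theta>)\<^sup>2))
     - (\<sigma>\<^sub>0 - \<alpha>\<^sub>0\<^sup>2 / 8) * (1/2) * circle_int (\<lambda>\<theta>. exp (2 * \<xi> \<theta>))
     - \<alpha>\<^sub>0 / 4 * circle_int (\<lambda>\<theta>. exp (2 * \<xi> \<theta>) * deriv chi \<theta>)
     + \<alpha>\<^sub>0\<^sup>2 / 32 * circle_int (\<lambda>\<theta>. exp (4 * \<xi> \<theta>)))"

definition J_alpha :: "real \<Rightarrow> (real \<Rightarrow> real) \<Rightarrow> state \<Rightarrow> state" where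
  "J_alpha \<alpha>\<^sub>0 \<xi> = (\<lambda>(g\<^sub>1, g\<^sub>2).
     (\<lambda>\<theta>. exp (- 2 * \<xi> \<theta>) * g\<^sub>2 \<theta>,
      \<lambda>\<theta>. - exp (- 2 * \<xi> \<theta>) * g\<^sub>1 \<theta> + \<alpha>\<^sub>0 * d_inv (Pi0_perp g\<^sub>2) \<theta>))"

definition J_can :: "(real \<Rightarrow> real) \<Rightarrow> state \<Rightarrow> state" where
  "J_can \<zeta> = (\<lambda>(g\<^sub>1, g\<^sub>2).
     (\<lambda>\<theta>. exp (- 2 * \<zeta> \<theta>) * g\<^sub>2 \<theta>,
      \<lambda>\<theta>. - exp (- 2 * \<zeta> \<theta>) * g\<^sub>1 \<theta>))"

definition C_map :: "real \<Rightarrow> state \<Rightarrow> state" where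
  "C_map \<alpha>\<^sub>0 = (\<lambda>(\<zeta>, \<gamma>).
     (\<zeta>, \<lambda>\<theta>. \<gamma> \<theta> + \<alpha>\<^sub>0 / 4 * d_inv (Pi0_perp (\<lambda>s. exp (2 * \<zeta> s))) \<theta>))"

end

theory Submission
  imports Defs
begin

text \<open>The argument holds for an arbitrary functional \<open>F\<close> in place of the Hamiltonian; no property of
  the Dirichlet--Neumann operator is used. Let \<open>A = \<partial>\<^sub>\<theta>\<^sup>-\<^sup>1 \<Pi>\<^sub>0\<^sup>\<bottom>\<close>, which is bounded on every \<open>C\<^sup>k\<close> and
  antisymmetric on \<open>L\<^sup>2\<close>. The shear \<open>C\<^sub>\<alpha> (u, v) = (u, v + \<alpha>/4 A e\<^sup>2\<^sup>u)\<close> has the inverse \<open>C\<^sub>-\<^sub>\<alpha>\<close>, and the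
  chain rule with the antisymmetry of \<open>A\<close> says that \<open>F \<circ> C\<^sub>\<alpha>\<close> has the gradient
  \<open>(g\<^sub>1 - \<alpha>/2 e\<^sup>2\<^sup>u A g\<^sub>2, g\<^sub>2)\<close> at \<open>(u, v)\<close> when \<open>F\<close> has the gradient \<open>(g\<^sub>1, g\<^sub>2)\<close> at \<open>C\<^sub>\<alpha> (u, v)\<close>.
  Along a solution \<open>\<partial>\<^sub>t u = e\<^sup>-\<^sup>2\<^sup>u g\<^sub>2\<close>, so \<open>\<partial>\<^sub>t (\<alpha>/4 A e\<^sup>2\<^sup>u) = \<alpha>/2 A g\<^sub>2\<close>. This and the change of \<open>g\<^sub>1\<close> each
  contribute \<open>\<alpha>/2 A g\<^sub>2\<close> to the second equation, so \<open>C\<^sub>\<alpha>\<close> carries solutions for \<open>J\<^sub>\<beta>\<close> to solutions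
  for \<open>J\<^sub>\<beta>\<^sub>+\<^sub>\<alpha>\<close>; the canonical structure is \<open>J\<^sub>0\<close>, and the two implications are the cases
  \<open>\<beta> = 0\<close> and \<open>\<beta> = \<alpha>\<^sub>0\<close> with shear parameter \<open>-\<alpha>\<^sub>0\<close>.\<close>

subsection \<open>Primitives and periodic functions\<close>

text \<open>The oriented integral inside \<open>d_inv\<close>. Since \<open>circle_int\<close> is
  its value at the end of one period, facts about both reduce to facts about
  antiderivatives.\<close>

definition primitive :: "(real \<Rightarrow> real) \<Rightarrow> real \<Rightarrow> real" where
  "primitive f = (\<lambda>\<theta>. LBINT s=0..\<theta>. f s)"

lemma circle_int_eq_primitive: "circle_int f = primitive f (2*pi)"
  by (simp add: circle_int_def primitive_def)

lemma primitive_0 [simp]: "primitive f 0 = 0"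
  by (simp add: primitive_def zero_ereal_def)

lemma primitive_eq:
  assumes "continuous_on UNIV f" "\<And>x. (F has_real_derivative f x) (at x)"
  shows "primitive f \<theta> = F \<theta> - F 0"
proof -
  have "(LBINT x=ereal 0..ereal \<theta>. f x) = F \<theta> - F 0"
    by (intro interval_integral_FTC_finite continuous_on_subset[OF assms(1)])
       (auto intro: has_field_derivative_at_within assms(2)
          simp: has_real_derivative_iff_has_vector_derivative[symmetric])
  then show ?thesis by (simp add: primitive_def zero_ereal_def)
qed

text \<open>A continuous function has an antiderivative on the whole line, and
  \<open>primitive_eq\<close> identifies it with the primitive up to a constant. No case split on
  the sign of \<theta> arises.\<close>

lemma primitive_has_derivative:
  assumes "continuous_on UNIV f"
  shows "(primitive f has_real_derivative f \<theta>) (at \<theta>)"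
proof -
  have "\<And>x. isCont f x"
    using assms by (simp add: continuous_on_eq_continuous_at)
  then obtain F where "\<And>x. (F has_real_derivative f x) (at x)"
    using einterval_antiderivative[of "-\<infinity>" "\<infinity>" f]
    by (auto simp: has_real_derivative_iff_has_vector_derivative)
  moreover from this have "primitive f = (\<lambda>\<theta>. F \<theta> - F 0)"
    using primitive_eq[OF assms] by blast
  ultimately show ?thesis by (auto intro!: derivative_eq_intros)
qed

lemma continuous_on_primitive [continuous_intros]:
  "continuous_on UNIV f \<Longrightarrow> continuous_on UNIV (primitive f)"
  by (meson DERIV_isCont continuous_at_imp_continuous_on primitive_has_derivative)

text \<open>The right side is an antiderivative of the integrand that vanishes at 0. Two
  coefficients let one rule serve sums, differences and multiples.\<close>

lemma primitive_linear:
  assumes "continuous_on UNIV f" "continuous_on UNIV g"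
  shows "primitive (\<lambda>x. a * f x + b * g x) \<theta> = a * primitive f \<theta> + b * primitive g \<theta>"
  using primitive_eq[of "\<lambda>x. a * f x + b * g x" "\<lambda>x. a * primitive f x + b * primitive g x" \<theta>]
  by (force intro!: continuous_intros assms derivative_eq_intros
      primitive_has_derivative[OF assms(1)] primitive_has_derivative[OF assms(2)])

lemma primitive_bound:
  assumes "continuous_on UNIV f" "\<And>x. \<bar>f x\<bar> \<le> M"
  shows "\<bar>primitive f \<theta>\<bar> \<le> M * \<bar>\<theta>\<bar>"
  using field_differentiable_bound[of UNIV "primitive f" f M 0 \<theta>]
    assms primitive_has_derivative[OF assms(1)] by simp

lemma circle_int_linear:
  assumes "continuous_on UNIV f" "continuous_on UNIV g"
  shows "circle_int (\<lambda>x. a * f x + b * g x) = a * circle_int f + b * circle_int g"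
  by (simp add: circle_int_eq_primitive primitive_linear assms)

lemma circle_int_bound:
  assumes "continuous_on UNIV f" "\<And>x. \<bar>f x\<bar> \<le> M"
  shows "\<bar>circle_int f\<bar> \<le> M * (2*pi)"
  using primitive_bound[OF assms, of "2*pi"] by (simp add: circle_int_eq_primitive)

lemma circle_int_const [simp]: "circle_int (\<lambda>_. c) = c * (2*pi)"
  by (simp add: circle_int_eq_primitive, subst primitive_eq[of _ "\<lambda>x. c * x"])
     (auto intro!: derivative_eq_intros)

section \<open>The mean-zero projection and the mean-free primitive\<close>

lemma continuous_on_Pi0_perp [continuous_intros]:
  "continuous_on UNIV f \<Longrightarrow> continuous_on UNIV (Pi0_perp f)"
  unfolding Pi0_perp_def by (intro continuous_intros)

lemma circle_int_Pi0_perp: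
  assumes "continuous_on UNIV f"
  shows "circle_int (Pi0_perp f) = 0"
  using circle_int_linear[OF assms continuous_on_const, of 1 "-1" "circle_int f / (2*pi)"]
  by (simp add: Pi0_perp_def)

lemma Pi0_perp_linear:
  assumes "continuous_on UNIV f" "continuous_on UNIV g"
  shows "Pi0_perp (\<lambda>x. a * f x + b * g x) = (\<lambda>x. a * Pi0_perp f x + b * Pi0_perp g x)"
  by (simp add: Pi0_perp_def circle_int_linear assms fun_eq_iff add_divide_distrib algebra_simps)

lemma Pi0_perp_bound:
  assumes "continuous_on UNIV f" "\<And>x. \<bar>f x\<bar> \<le> M"
  shows "\<bar>Pi0_perp f x\<bar> \<le> 2 * M"
proof -
  have "\<bar>circle_int f / (2*pi)\<bar> \<le> M"
    using circle_int_bound[OF assms] by (simp add: abs_mult field_simps)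
  with assms(2)[of x] show ?thesis unfolding Pi0_perp_def by linarith
qed

definition mean_free_primitive :: "(real \<Rightarrow> real) \<Rightarrow> real \<Rightarrow> real" where
  "mean_free_primitive f = d_inv (Pi0_perp f)"

lemma mean_free_primitive_eq: "mean_free_primitive f = Pi0_perp (primitive (Pi0_perp f))"
  by (simp add: mean_free_primitive_def d_inv_def primitive_def)

lemma continuous_on_mean_free_primitive [continuous_intros]:
  "continuous_on UNIV f \<Longrightarrow> continuous_on UNIV (mean_free_primitive f)"
  unfolding mean_free_primitive_eq by (intro continuous_intros)

lemma mean_free_primitive_has_derivative:
  assumes "continuous_on UNIV f"
  shows "(mean_free_primitive f has_real_derivative Pi0_perp f \<theta>) (at \<theta>)"
  unfolding mean_free_primitive_eq Pi0_perp_def[of "primitive _"]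
  by (auto intro!: derivative_eq_intros primitive_has_derivative continuous_intros assms)

lemma circle_int_mean_free_primitive:
  "continuous_on UNIV f \<Longrightarrow> circle_int (mean_free_primitive f) = 0"
  unfolding mean_free_primitive_eq by (intro circle_int_Pi0_perp continuous_intros)

lemma mean_free_primitive_linear:
  assumes "continuous_on UNIV f" "continuous_on UNIV g"
  shows "mean_free_primitive (\<lambda>x. a * f x + b * g x) =
    (\<lambda>x. a * mean_free_primitive f x + b * mean_free_primitive g x)"
proof -
  have "primitive (Pi0_perp (\<lambda>x. a * f x + b * g x)) =
    (\<lambda>x. a * primitive (Pi0_perp f) x + b * primitive (Pi0_perp g) x)"
    by (simp add: Pi0_perp_linear primitive_linear assms continuous_on_Pi0_perp fun_eq_iff)
  then show ?thesis
    by (simp add: mean_free_primitive_eq Pi0_perp_linear assms continuous_intros)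
qed

section \<open>The spaces of periodic C^k functions and their closure properties\<close>

lemma circle_Ck_0: "f \<in> circle_Ck 0 \<longleftrightarrow> (\<forall>\<theta>. f (\<theta> + 2*pi) = f \<theta>) \<and> continuous_on UNIV f"
  by (simp add: circle_Ck_def)

lemma deriv_eqI: "(\<And>x. (f has_real_derivative g x) (at x)) \<Longrightarrow> deriv f = g"
  by (auto simp: fun_eq_iff intro: DERIV_imp_deriv)

lemma deriv_periodic:
  assumes "\<And>x. f (x + p) = f x" "\<And>x. (f has_real_derivative g x) (at x)"
  shows "g (x + p) = g x"
  using assms(2)[of x] assms(2)[of "x + p"] assms(1) by (simp add: DERIV_shift DERIV_unique)

text \<open>Peeling off the innermost derivative turns the conditions on \<open>f\<close> at order
  \<open>Suc k\<close> into conditions on \<open>deriv f\<close> at order \<open>k\<close>. The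
  closure and norm estimates below are inductions along this recursion.\<close>

lemma circle_Ck_Suc:
  "f \<in> circle_Ck (Suc k) \<longleftrightarrow>
    (\<forall>\<theta>. f (\<theta> + 2*pi) = f \<theta>) \<and> (\<exists>g\<in>circle_Ck k. \<forall>\<theta>. (f has_real_derivative g \<theta>) (at \<theta>))"
  (is "_ \<longleftrightarrow> ?per \<and> ?ex")
proof -
  have split: "(\<forall>j<Suc k. (deriv ^^ j) f differentiable_on UNIV) \<longleftrightarrow>
      f differentiable_on UNIV \<and> (\<forall>j<k. (deriv ^^ j) (deriv f) differentiable_on UNIV)"
    by (auto simp: less_Suc_eq_0_disj funpow_swap1)
  have D: "(\<forall>\<theta>. (f has_real_derivative deriv f \<theta>) (at \<theta>))" if "f differentiable_on UNIV"
    using that by (simp add: DERIV_deriv_iff_real_differentiable differentiable_on_def)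
  show ?thesis
  proof
    assume f: "f \<in> circle_Ck (Suc k)"
    then have per: ?per and dif: "f differentiable_on UNIV"
      by (auto simp: circle_Ck_def)
    have "deriv f \<in> circle_Ck k"
      using f split deriv_periodic[OF per[rule_format] D[OF dif, rule_format]]
      by (simp add: circle_Ck_def funpow_swap1)
    then show "?per \<and> ?ex" using per D[OF dif] by blast
  next
    assume "?per \<and> ?ex"
    then obtain g where per: ?per and g: "g \<in> circle_Ck k"
      and fg: "\<And>\<theta>. (f has_real_derivative g \<theta>) (at \<theta>)" by blast
    have "deriv f = g" using fg by (rule deriv_eqI)
    moreover have "f differentiable_on UNIV"
      using fg by (metis differentiable_on_def has_field_derivative_at_within real_differentiable_def)
    ultimately show "f \<in> circle_Ck (Suc k)"
      using per g split by (simp add: circle_Ck_def funpow_swap1)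
  qed
qed

lemma circle_Ck_SucE:
  assumes "f \<in> circle_Ck (Suc k)"
  obtains g where "g \<in> circle_Ck k" "deriv f = g" "\<And>\<theta>. (f has_real_derivative g \<theta>) (at \<theta>)"
  using assms deriv_eqI by (metis circle_Ck_Suc)

lemma circle_Ck_Suc_subset: "circle_Ck (Suc k) \<subseteq> circle_Ck k"
proof (induction k)
  case 0
  then show ?case
    by (auto simp: circle_Ck_Suc circle_Ck_0) (meson DERIV_isCont continuous_at_imp_continuous_on)
next
  case (Suc k)
  show ?case
  proof
    fix f assume "f \<in> circle_Ck (Suc (Suc k))"
    then show "f \<in> circle_Ck (Suc k)"
      using Suc.IH by (subst (asm) circle_Ck_Suc) (auto simp: circle_Ck_Suc[of f k])
  qed
qed

lemma circle_Ck_antimono: "j \<le> k \<Longrightarrow> circle_Ck k \<subseteq> circle_Ck j"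
  by (induction rule: dec_induct) (use circle_Ck_Suc_subset in blast)+

lemma circle_Ck_periodic: "f \<in> circle_Ck k \<Longrightarrow> f (\<theta> + 2*pi) = f \<theta>"
  by (simp add: circle_Ck_def)

lemma circle_Ck_continuous: "f \<in> circle_Ck k \<Longrightarrow> continuous_on UNIV f"
  using circle_Ck_antimono[of 0 k] by (auto simp: circle_Ck_0)

lemma circle_Ck_const: "(\<lambda>_. c) \<in> circle_Ck k"
proof (induction k arbitrary: c)
  case 0
  then show ?case by (simp add: circle_Ck_0)
next
  case (Suc k)
  then show ?case by (auto simp: circle_Ck_Suc intro!: bexI[of _ "\<lambda>_. 0"])
qed

lemma circle_Ck_add:
  "f \<in> circle_Ck k \<Longrightarrow> g \<in> circle_Ck k \<Longrightarrow> (\<lambda>x. f x + g x) \<in> circle_Ck k"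
proof (induction k arbitrary: f g)
  case 0
  then show ?case by (auto simp: circle_Ck_0 intro!: continuous_intros)
next
  case (Suc k)
  then show ?case unfolding circle_Ck_Suc by (auto intro!: derivative_eq_intros)
qed

text \<open>Induction with the product rule; the functions are generalized because the hypothesis is
  applied to the pairs \<open>f'\<close>, \<open>g\<close> and \<open>f\<close>,
  \<open>g'\<close>.\<close>

lemma circle_Ck_mult:
  "f \<in> circle_Ck k \<Longrightarrow> g \<in> circle_Ck k \<Longrightarrow> (\<lambda>x. f x * g x) \<in> circle_Ck k"
proof (induction k arbitrary: f g)
  case 0
  then show ?case by (auto simp: circle_Ck_0 intro!: continuous_intros)
next
  case (Suc k)
  obtain f' g' where fg: "f' \<in> circle_Ck k" "\<And>x. (f has_real_derivative f' x) (at x)"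
    "g' \<in> circle_Ck k" "\<And>x. (g has_real_derivative g' x) (at x)"
    using Suc.prems by (metis circle_Ck_SucE)
  have "f \<in> circle_Ck k" "g \<in> circle_Ck k"
    using Suc.prems circle_Ck_Suc_subset by auto
  then have "(\<lambda>x. f' x * g x + f x * g' x) \<in> circle_Ck k"
    by (intro circle_Ck_add Suc.IH fg)
  then show ?case using Suc.prems fg
    unfolding circle_Ck_Suc
    by (auto intro!: bexI[of _ "\<lambda>x. f' x * g x + f x * g' x"] derivative_eq_intros)
qed

lemma circle_Ck_exp: "f \<in> circle_Ck k \<Longrightarrow> (\<lambda>x. exp (f x)) \<in> circle_Ck k"
proof (induction k arbitrary: f)
  case 0
  then show ?case by (auto simp: circle_Ck_0 intro!: continuous_intros)
next
  case (Suc k)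
  obtain f' where f: "f' \<in> circle_Ck k" "\<And>x. (f has_real_derivative f' x) (at x)"
    using Suc.prems by (metis circle_Ck_SucE)
  have "(\<lambda>x. exp (f x) * f' x) \<in> circle_Ck k"
    using Suc circle_Ck_Suc_subset f by (intro circle_Ck_mult) auto
  then show ?case using Suc.prems f
    unfolding circle_Ck_Suc
    by (auto intro!: bexI[of _ "\<lambda>x. exp (f x) * f' x"] derivative_eq_intros)
qed

lemma circle_Ck_scale: "f \<in> circle_Ck k \<Longrightarrow> (\<lambda>x. c * f x) \<in> circle_Ck k"
  by (intro circle_Ck_mult circle_Ck_const)

lemma circle_Ck_Pi0_perp: "f \<in> circle_Ck k \<Longrightarrow> Pi0_perp f \<in> circle_Ck k"
  using circle_Ck_add[OF _ circle_Ck_const, of f k "- circle_int f / (2*pi)"]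
  by (simp add: Pi0_perp_def)

text \<open>Integration gains one derivative. Periodicity is where the zero average enters: the
  increment of the primitive over one period does not depend on the starting point, and from 0 it is
  the integral of a mean-zero function.\<close>

lemma circle_Ck_mean_free_primitive_Suc:
  assumes "f \<in> circle_Ck k"
  shows "mean_free_primitive f \<in> circle_Ck (Suc k)"
proof -
  let ?A = "mean_free_primitive f" and ?P = "primitive (Pi0_perp f)"
  note cont = circle_Ck_continuous[OF assms]
  have per: "Pi0_perp f (x + 2*pi) = Pi0_perp f x" for x
    using circle_Ck_periodic[OF assms] by (simp add: Pi0_perp_def)
  have P: "(?P has_real_derivative Pi0_perp f x) (at x)" for x
    by (intro primitive_has_derivative continuous_intros cont)
  have "((\<lambda>x. ?P (x + 2*pi) - ?P x) has_real_derivative 0) (at x)" for x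
    using P[of "x + 2*pi"] P[of x] by (auto simp: DERIV_shift per intro!: derivative_eq_intros)
  then have "?P (x + 2*pi) - ?P x = ?P (0 + 2*pi) - ?P 0" for x
    using DERIV_isconst_all[of "\<lambda>x. ?P (x + 2*pi) - ?P x" x 0] by blast
  then have "?P (x + 2*pi) = ?P x" for x
    using circle_int_Pi0_perp[OF cont] by (simp add: circle_int_eq_primitive)
  then have "?A (x + 2*pi) = ?A x" for x
    unfolding mean_free_primitive_eq Pi0_perp_def[of "primitive _"] by simp
  then show ?thesis
    using mean_free_primitive_has_derivative[OF cont] circle_Ck_Pi0_perp[OF assms]
    unfolding circle_Ck_Suc by blast
qed

lemma circle_Ck_mean_free_primitive:
  "f \<in> circle_Ck k \<Longrightarrow> mean_free_primitive f \<in> circle_Ck k"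
  using circle_Ck_mean_free_primitive_Suc circle_Ck_Suc_subset by blast

text \<open>Integration by parts: the product of A f and A g is periodic, so its derivative
  integrates to zero over one period.\<close>

lemma circle_int_antisymmetric:
  assumes f: "f \<in> circle_Ck 0" and g: "g \<in> circle_Ck 0"
  shows "circle_int (\<lambda>x. mean_free_primitive f x * g x) =
    - circle_int (\<lambda>x. f x * mean_free_primitive g x)"
proof -
  let ?A = "mean_free_primitive"
  note c = circle_Ck_continuous[OF f] circle_Ck_continuous[OF g]
  have per: "?A h (2*pi) = ?A h 0" if "h \<in> circle_Ck 0" for h
    using circle_Ck_periodic[OF circle_Ck_mean_free_primitive[OF that], of 0] by simp
  \<comment> \<open>As A u has zero average, it does not see the constant by which v and its
    projection differ.\<close>
  have m: "circle_int (\<lambda>x. ?A u x * v x) = circle_int (\<lambda>x. ?A u x * Pi0_perp v x)"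
    if "continuous_on UNIV u" "continuous_on UNIV v" for u v
    using circle_int_linear[of "\<lambda>x. ?A u x * v x" "?A u" 1 "- circle_int v / (2*pi)"]
    by (simp add: Pi0_perp_def right_diff_distrib circle_int_mean_free_primitive that mult.commute
        continuous_intros)
  have "circle_int (\<lambda>x. 1 * (?A f x * Pi0_perp g x) + 1 * (?A g x * Pi0_perp f x)) = 0"
    unfolding circle_int_eq_primitive
    by (subst primitive_eq[of _ "\<lambda>x. ?A f x * ?A g x"])
       (auto simp: per f g c intro!: continuous_intros derivative_eq_intros
          mean_free_primitive_has_derivative)
  then have "circle_int (\<lambda>x. ?A f x * Pi0_perp g x) + circle_int (\<lambda>x. ?A g x * Pi0_perp f x) = 0"
    by (subst (asm) circle_int_linear) (auto intro!: continuous_intros c)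
  then show ?thesis using m[of f g] m[of g f] c by (simp add: mult.commute)
qed

subsection \<open>Estimates in the norms of the spaces of periodic functions\<close>

text \<open>Subtracting \<open>\<lfloor>x / (2*pi)\<rfloor>\<close> periods moves any point into the
  compact interval of one period, where continuity gives bounds.\<close>

lemma periodic_interval_cases:
  assumes "\<And>x. f (x + 2*pi) = (f x :: real)"
  obtains y where "0 \<le> y" "y \<le> 2*pi" "f x = f y"
proof -
  interpret periodic_fun_simple f "2*pi"
    by unfold_locales (rule assms)
  let ?n = "\<lfloor>x / (2*pi)\<rfloor>"
  have "real_of_int ?n \<le> x / (2*pi)" "x / (2*pi) \<le> real_of_int ?n + 1"
    by linarith+
  then have "real_of_int ?n * (2*pi) \<le> x" "x \<le> (real_of_int ?n + 1) * (2*pi)"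
    using pos_le_divide_eq[of "2*pi" "real_of_int ?n" x]
      pos_divide_le_eq[of "2*pi" x "real_of_int ?n + 1"] by simp_all
  moreover have "f x = f (x - real_of_int ?n * (2*pi))"
    using minus_of_int[of x ?n] by simp
  ultimately show ?thesis
    by (intro that[of "x - real_of_int ?n * (2*pi)"]) (auto simp: algebra_simps)
qed

text \<open>Makes the suprema in \<open>Ck_norm\<close> genuine: on the reals, \<open>SUP\<close> is
  a least upper bound only for sets that are bounded above and nonempty.\<close>

lemma circle_Ck_bdd:
  assumes "f \<in> circle_Ck 0"
  shows "bdd_above (range (\<lambda>x. \<bar>f x\<bar>))"
proof -
  have "compact ((\<lambda>x. \<bar>f x\<bar>) ` {0..2*pi})"
    by (intro compact_continuous_image continuous_intros
        continuous_on_subset[OF circle_Ck_continuous[OF assms]]) auto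
  then obtain M where M: "\<And>x. 0 \<le> x \<Longrightarrow> x \<le> 2*pi \<Longrightarrow> \<bar>f x\<bar> \<le> M"
    by (fastforce dest!: compact_imp_bounded simp: bounded_iff)
  have "\<bar>f x\<bar> \<le> M" for x
    by (rule periodic_interval_cases[of f x]) (simp_all add: M circle_Ck_periodic[OF assms])
  then show ?thesis by (intro bdd_aboveI[of _ M]) auto
qed

lemma Ck_norm_0: "Ck_norm 0 f = (SUP x. \<bar>f x\<bar>)"
  by (simp add: Ck_norm_def)

text \<open>The counterpart of \<open>circle_Ck_Suc\<close> for norms: the sum over derivatives is
  split at its zeroth term.\<close>

lemma Ck_norm_Suc: "Ck_norm (Suc k) f = Ck_norm 0 f + Ck_norm k (deriv f)"
  by (simp add: Ck_norm_def sum.atMost_Suc_shift funpow_swap1 del: sum.atMost_Suc)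

lemma Ck_norm_Suc_eq:
  "(\<And>x. (f has_real_derivative g x) (at x)) \<Longrightarrow> Ck_norm (Suc k) f = Ck_norm 0 f + Ck_norm k g"
  unfolding Ck_norm_Suc using deriv_eqI[of f g] by simp

lemma abs_le_Ck_norm_0: "f \<in> circle_Ck 0 \<Longrightarrow> \<bar>f x\<bar> \<le> Ck_norm 0 f"
  unfolding Ck_norm_0 by (intro cSUP_upper circle_Ck_bdd) auto

lemma Ck_norm_0_le: "(\<And>x. \<bar>f x\<bar> \<le> M) \<Longrightarrow> Ck_norm 0 f \<le> M"
  unfolding Ck_norm_0 by (intro cSUP_least) auto

lemma Ck_norm_nonneg: "f \<in> circle_Ck k \<Longrightarrow> 0 \<le> Ck_norm k f"
proof (induction k arbitrary: f)
  case 0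
  then show ?case using abs_le_Ck_norm_0[of f 0] by linarith
next
  case (Suc k)
  then have "f \<in> circle_Ck 0" using circle_Ck_antimono[of 0 "Suc k"] by auto
  then have "0 \<le> Ck_norm 0 f" using abs_le_Ck_norm_0[of f 0] by linarith
  with Suc show ?case by (auto simp: Ck_norm_Suc elim!: circle_Ck_SucE)
qed

lemma Ck_norm_0_le_Ck_norm:
  assumes "f \<in> circle_Ck k"
  shows "Ck_norm 0 f \<le> Ck_norm k f"
  using assms by (cases k) (auto simp: Ck_norm_Suc intro: Ck_norm_nonneg elim!: circle_Ck_SucE)

lemma Ck_norm_le_Suc: "f \<in> circle_Ck (Suc k) \<Longrightarrow> Ck_norm k f \<le> Ck_norm (Suc k) f"
proof (induction k arbitrary: f)
  case 0
  then show ?case by (rule Ck_norm_0_le_Ck_norm)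
next
  case (Suc k)
  then show ?case by (metis Ck_norm_Suc add_left_mono circle_Ck_SucE)
qed

lemma abs_le_Ck_norm: "f \<in> circle_Ck k \<Longrightarrow> \<bar>f x\<bar> \<le> Ck_norm k f"
  using Ck_norm_0_le_Ck_norm abs_le_Ck_norm_0 circle_Ck_antimono[of 0 k]
  by (meson le0 order_trans subsetD)

lemma Ck_norm_add:
  "f \<in> circle_Ck k \<Longrightarrow> g \<in> circle_Ck k \<Longrightarrow> Ck_norm k (\<lambda>x. f x + g x) \<le> Ck_norm k f + Ck_norm k g"
proof (induction k arbitrary: f g)
  case 0
  show ?case
  proof (rule Ck_norm_0_le)
    fix x
    show "\<bar>f x + g x\<bar> \<le> Ck_norm 0 f + Ck_norm 0 g"
      using abs_le_Ck_norm_0[OF 0(1), of x] abs_le_Ck_norm_0[OF 0(2), of x] by linarith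
  qed
next
  case (Suc k)
  obtain f' g' where fg: "f' \<in> circle_Ck k" "\<And>x. (f has_real_derivative f' x) (at x)"
    "g' \<in> circle_Ck k" "\<And>x. (g has_real_derivative g' x) (at x)"
    using Suc.prems by (metis circle_Ck_SucE)
  have "f \<in> circle_Ck 0" "g \<in> circle_Ck 0"
    using Suc.prems circle_Ck_antimono[of 0 "Suc k"] by auto
  then have "Ck_norm 0 (\<lambda>x. f x + g x) \<le> Ck_norm 0 f + Ck_norm 0 g"
    by (intro Ck_norm_0_le order_trans[OF abs_triangle_ineq] add_mono abs_le_Ck_norm_0)
  moreover have "Ck_norm (Suc k) (\<lambda>x. f x + g x) = Ck_norm 0 (\<lambda>x. f x + g x) + Ck_norm k (\<lambda>x. f' x + g' x)"
    by (intro Ck_norm_Suc_eq) (auto intro!: derivative_eq_intros fg)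
  ultimately show ?case
    using Suc.IH[OF fg(1,3)] by (simp add: Ck_norm_Suc_eq[OF fg(2)] Ck_norm_Suc_eq[OF fg(4)])
qed

lemma Ck_norm_const: "Ck_norm k (\<lambda>_. c) = \<bar>c\<bar>"
proof (induction k arbitrary: c)
  case 0
  then show ?case by (simp add: Ck_norm_0)
next
  case (Suc k)
  have "Ck_norm (Suc k) (\<lambda>_. c) = Ck_norm 0 (\<lambda>_. c) + Ck_norm k (\<lambda>_. 0)"
    by (intro Ck_norm_Suc_eq) auto
  with Suc show ?case by (simp add: Ck_norm_0)
qed

text \<open>The constant doubles with each order because the product rule produces two
  terms.\<close>

lemma Ck_norm_mult:
  "f \<in> circle_Ck k \<Longrightarrow> g \<in> circle_Ck k \<Longrightarrow>
    Ck_norm k (\<lambda>x. f x * g x) \<le> 2^k * (Ck_norm k f * Ck_norm k g)"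
proof (induction k arbitrary: f g)
  case 0
  show ?case
    unfolding power_0 mult_1
    by (intro Ck_norm_0_le) (simp only: abs_mult, intro mult_mono abs_le_Ck_norm Ck_norm_nonneg 0 abs_ge_zero)
next
  case (Suc k)
  obtain f' g' where fg: "f' \<in> circle_Ck k" "\<And>x. (f has_real_derivative f' x) (at x)"
    "g' \<in> circle_Ck k" "\<And>x. (g has_real_derivative g' x) (at x)"
    using Suc.prems by (metis circle_Ck_SucE)
  have C: "f \<in> circle_Ck k" "g \<in> circle_Ck k" "f \<in> circle_Ck 0" "g \<in> circle_Ck 0"
    using Suc.prems circle_Ck_antimono[of 0 "Suc k"] circle_Ck_Suc_subset[of k] by auto
  define a b a' b' where "a = Ck_norm 0 f" "b = Ck_norm 0 g" "a' = Ck_norm k f'" "b' = Ck_norm k g'"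
  note ab = this
  have nn: "0 \<le> a" "0 \<le> b" "0 \<le> a'" "0 \<le> b'"
    unfolding ab using C fg by (auto intro: Ck_norm_nonneg)
  have S: "Ck_norm (Suc k) f = a + a'" "Ck_norm (Suc k) g = b + b'"
    by (simp_all add: ab Ck_norm_Suc_eq[OF fg(2)] Ck_norm_Suc_eq[OF fg(4)])
  have le: "Ck_norm k f \<le> a + a'" "Ck_norm k g \<le> b + b'"
    using Ck_norm_le_Suc Suc.prems S by metis+
  have "Ck_norm 0 (\<lambda>x. f x * g x) \<le> a * b"
    unfolding ab using C
    by (intro Ck_norm_0_le) (simp only: abs_mult, intro mult_mono abs_le_Ck_norm Ck_norm_nonneg abs_ge_zero)
  moreover have "Ck_norm (Suc k) (\<lambda>x. f x * g x) =
      Ck_norm 0 (\<lambda>x. f x * g x) + Ck_norm k (\<lambda>x. f' x * g x + f x * g' x)"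
    by (intro Ck_norm_Suc_eq) (auto intro!: derivative_eq_intros fg)
  moreover have "Ck_norm k (\<lambda>x. f' x * g x + f x * g' x) \<le>
      Ck_norm k (\<lambda>x. f' x * g x) + Ck_norm k (\<lambda>x. f x * g' x)"
    by (intro Ck_norm_add circle_Ck_mult fg C)
  moreover have "Ck_norm k (\<lambda>x. f' x * g x) \<le> 2^k * (a' * (b + b'))"
    using le nn unfolding ab(3)
    by (intro order_trans[OF Suc.IH[OF fg(1) C(2)]] mult_left_mono) auto
  moreover have "Ck_norm k (\<lambda>x. f x * g' x) \<le> 2^k * ((a + a') * b')"
    using le nn unfolding ab(4)
    by (intro order_trans[OF Suc.IH[OF C(1) fg(3)]] mult_left_mono mult_right_mono) auto
  ultimately have "Ck_norm (Suc k) (\<lambda>x. f x * g x) \<le>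
      a * b + 2^k * (a' * (b + b') + (a + a') * b')"
    by (simp add: distrib_left)
  \<comment> \<open>With the factor \<open>2^k\<close> on every term, it remains to compare with
    \<open>2 * ((a + a') * (b + b'))\<close>, which exceeds the bracket by
    \<open>a*b + a*b' + a'*b\<close>.\<close>
  also have "\<dots> \<le> 2^k * (a * b) + 2^k * (a' * (b + b') + (a + a') * b')"
    using nn mult_right_mono[of 1 "2^k" "a*b"] by simp
  also have "\<dots> \<le> 2^k * (2 * ((a + a') * (b + b')))"
    using nn by (simp add: distrib_left[symmetric]) (simp add: algebra_simps)
  finally show ?case unfolding S by (simp only: power_Suc mult_ac)
qed

text \<open>The scalar is treated as a constant function, which costs the factor \<open>2^k\<close>;
  only the existence of some bound matters below.\<close>

lemma Ck_norm_scale: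
  "f \<in> circle_Ck k \<Longrightarrow> Ck_norm k (\<lambda>x. c * f x) \<le> 2^k * (\<bar>c\<bar> * Ck_norm k f)"
  using Ck_norm_mult[OF circle_Ck_const, of f k c] by (simp add: Ck_norm_const)

lemma Ck_norm_Pi0_perp:
  assumes "f \<in> circle_Ck k"
  shows "Ck_norm k (Pi0_perp f) \<le> 2 * Ck_norm k f"
proof -
  have "\<bar>circle_int f / (2*pi)\<bar> \<le> Ck_norm k f"
    using circle_int_bound[OF circle_Ck_continuous[OF assms] abs_le_Ck_norm[OF assms]]
    by (simp add: abs_mult field_simps)
  then show ?thesis
    using Ck_norm_add[OF assms circle_Ck_const, of "- circle_int f / (2*pi)"]
    by (simp add: Pi0_perp_def Ck_norm_const)
qed

text \<open>The inner and the outer projection each cost a factor 2, and integration over at most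
  one period costs \<open>2*pi\<close>. Periodicity of the primitive extends the bound to the
  line.\<close>

lemma mean_free_primitive_bound:
  assumes "f \<in> circle_Ck 0" "\<And>x. \<bar>f x\<bar> \<le> M"
  shows "\<bar>mean_free_primitive f x\<bar> \<le> 8 * pi * M"
proof -
  note cont = circle_Ck_continuous[OF assms(1)]
  let ?A = "mean_free_primitive f" and ?P = "primitive (Pi0_perp f)"
  have "0 \<le> M" using assms(2)[of 0] by linarith
  have P: "\<bar>?P y\<bar> \<le> 4 * pi * M" if "0 \<le> y" "y \<le> 2*pi" for y
  proof -
    have "\<bar>?P y\<bar> \<le> 2 * M * \<bar>y\<bar>"
      by (intro primitive_bound Pi0_perp_bound continuous_intros cont assms)
    also have "\<dots> \<le> 2 * M * (2*pi)"
      using that \<open>0 \<le> M\<close> by (intro mult_left_mono) auto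
    finally show ?thesis by (simp add: mult_ac)
  qed
  have per: "?P (y + 2*pi) = ?P y" for y
    using circle_Ck_periodic[OF circle_Ck_mean_free_primitive[OF assms(1)], of y]
    unfolding mean_free_primitive_eq by (simp add: Pi0_perp_def[of "primitive _"])
  have "\<bar>?P y\<bar> \<le> 4 * pi * M" for y
    by (rule periodic_interval_cases[of ?P y]) (simp_all only: P per)
  then have "\<bar>?A x\<bar> \<le> 2 * (4 * pi * M)"
    unfolding mean_free_primitive_eq by (intro Pi0_perp_bound continuous_intros cont)
  then show ?thesis by simp
qed

text \<open>The norm of order \<open>Suc k\<close> is bounded first: \<open>8 * pi\<close> comes
  from the supremum of A f, and 2 from its derivative, the projection of f.\<close>

lemma Ck_norm_mean_free_primitive:
  assumes "f \<in> circle_Ck k"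
  shows "Ck_norm k (mean_free_primitive f) \<le> (8 * pi + 2) * Ck_norm k f"
proof -
  have f0: "f \<in> circle_Ck 0" using assms circle_Ck_antimono[of 0 k] by auto
  have "Ck_norm 0 (mean_free_primitive f) \<le> 8 * pi * Ck_norm k f"
    by (intro Ck_norm_0_le mean_free_primitive_bound f0 abs_le_Ck_norm assms)
  moreover have "Ck_norm k f \<ge> 0" by (rule Ck_norm_nonneg[OF assms])
  moreover have "Ck_norm (Suc k) (mean_free_primitive f) =
      Ck_norm 0 (mean_free_primitive f) + Ck_norm k (Pi0_perp f)"
    by (intro Ck_norm_Suc_eq mean_free_primitive_has_derivative circle_Ck_continuous[OF assms])
  ultimately show ?thesis
    using Ck_norm_Pi0_perp[OF assms] Ck_norm_le_Suc[OF circle_Ck_mean_free_primitive_Suc[OF assms]]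
    by (simp add: distrib_right)
qed

section \<open>Taylor estimates for the exponential, pointwise and in C^k\<close>

lemma abs_exp_minus_1_le:
  fixes x :: real
  assumes "\<bar>x\<bar> \<le> 1"
  shows "\<bar>exp x - 1\<bar> \<le> 3 * \<bar>x\<bar>"
proof -
  obtain t where t: "\<bar>t\<bar> \<le> \<bar>x\<bar>" "exp x = 1 + exp t * x"
    using Maclaurin_exp_le[of x 1] by auto
  have "exp t \<le> exp 1" using t assms by simp
  then have "exp t \<le> 3" using exp_le by linarith
  then have "exp t * \<bar>x\<bar> \<le> 3 * \<bar>x\<bar>" by (intro mult_right_mono) auto
  then show ?thesis using t by (simp add: abs_mult)
qed

lemma abs_exp_minus_linear_le:
  fixes x :: real
  assumes "\<bar>x\<bar> \<le> 1"
  shows "\<bar>exp x - 1 - x\<bar> \<le> 2 * x\<^sup>2"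
proof -
  obtain t where t: "\<bar>t\<bar> \<le> \<bar>x\<bar>" "exp x = 1 + x + exp t / 2 * x\<^sup>2"
    using Maclaurin_exp_le[of x 2] by (auto simp: numeral_2_eq_2)
  have "exp t \<le> exp 1" using t assms by simp
  then have "exp t / 2 \<le> 2" using exp_le by linarith
  then have "exp t / 2 * x\<^sup>2 \<le> 2 * x\<^sup>2" by (intro mult_right_mono) auto
  then show ?thesis using t by simp
qed

text \<open>A linear bound at 0, uniform on the unit ball. In the induction the derivative is
  \<open>exp (f x) * f' x\<close>, whose first factor has norm at most \<open>C + 1\<close> by the
  hypothesis and whose second factor supplies the smallness.\<close>

lemma Ck_norm_exp_minus_1:
  obtains C where "0 \<le> C"
    "\<And>f. f \<in> circle_Ck k \<Longrightarrow> Ck_norm k f \<le> 1 \<Longrightarrow> Ck_norm k (\<lambda>x. exp (f x) - 1) \<le> C * Ck_norm k f"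
proof -
  have base: "Ck_norm 0 (\<lambda>x. exp (f x) - 1) \<le> 3 * Ck_norm 0 f"
    if "f \<in> circle_Ck 0" "Ck_norm 0 f \<le> 1" for f
  proof (rule Ck_norm_0_le)
    fix x
    have "\<bar>f x\<bar> \<le> Ck_norm 0 f" by (rule abs_le_Ck_norm[OF that(1)])
    then show "\<bar>exp (f x) - 1\<bar> \<le> 3 * Ck_norm 0 f"
      using abs_exp_minus_1_le[of "f x"] that(2) by linarith
  qed
  have "\<exists>C\<ge>0. \<forall>f\<in>circle_Ck k. Ck_norm k f \<le> 1 \<longrightarrow> Ck_norm k (\<lambda>x. exp (f x) - 1) \<le> C * Ck_norm k f"
  proof (induction k)
    case 0
    show ?case using base by (intro exI[of _ 3]) auto
  next
    case (Suc k)
    then obtain C where C: "C \<ge> 0" "\<And>f. f \<in> circle_Ck k \<Longrightarrow> Ck_norm k f \<le> 1 \<Longrightarrow>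
      Ck_norm k (\<lambda>x. exp (f x) - 1) \<le> C * Ck_norm k f" by blast
    \<comment> \<open>The summand 3 serves the supremum of \<open>exp (f x) - 1\<close>, the other
      one the product estimate for its derivative.\<close>
    define D where "D = 3 + 2^k * (C + 1)"
    have "Ck_norm (Suc k) (\<lambda>x. exp (f x) - 1) \<le> D * Ck_norm (Suc k) f"
      if f: "f \<in> circle_Ck (Suc k)" "Ck_norm (Suc k) f \<le> 1" for f
    proof -
      obtain f' where f': "f' \<in> circle_Ck k" "\<And>x. (f has_real_derivative f' x) (at x)"
        using f by (metis circle_Ck_SucE)
      have fk: "f \<in> circle_Ck k" "f \<in> circle_Ck 0"
        using f circle_Ck_antimono[of 0 "Suc k"] circle_Ck_Suc_subset[of k] by auto
      have nk: "Ck_norm k f \<le> 1" using Ck_norm_le_Suc f by fastforce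
      have n0: "Ck_norm 0 f \<le> 1" using Ck_norm_0_le_Ck_norm f by fastforce
      have nn: "0 \<le> Ck_norm 0 f" "0 \<le> Ck_norm k f'"
        using fk f' by (auto intro: Ck_norm_nonneg)
      have "(\<lambda>x. exp (f x) - 1) \<in> circle_Ck k"
        using circle_Ck_add[OF circle_Ck_exp[OF fk(1)] circle_Ck_const[of "-1"]] by simp
      from Ck_norm_add[OF this circle_Ck_const[of 1]]
      have "Ck_norm k (\<lambda>x. exp (f x)) \<le> C * Ck_norm k f + 1"
        using C(2)[OF fk(1) nk] by (simp add: Ck_norm_const)
      also have "\<dots> \<le> C + 1" using C(1) nk by (simp add: mult_left_le)
      finally have e: "Ck_norm k (\<lambda>x. exp (f x)) \<le> C + 1" .
      have "Ck_norm k (\<lambda>x. exp (f x) * f' x) \<le> 2^k * (Ck_norm k (\<lambda>x. exp (f x)) * Ck_norm k f')"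
        by (intro Ck_norm_mult circle_Ck_exp fk f')
      also have "\<dots> \<le> 2^k * ((C + 1) * Ck_norm k f')"
        using e nn by (intro mult_left_mono mult_right_mono) auto
      finally have 1: "Ck_norm k (\<lambda>x. exp (f x) * f' x) \<le> 2^k * (C + 1) * Ck_norm k f'"
        by simp
      have 2: "Ck_norm 0 (\<lambda>x. exp (f x) - 1) \<le> 3 * Ck_norm 0 f"
        by (rule base[OF fk(2) n0])
      have "Ck_norm (Suc k) (\<lambda>x. exp (f x) - 1) =
        Ck_norm 0 (\<lambda>x. exp (f x) - 1) + Ck_norm k (\<lambda>x. exp (f x) * f' x)"
        by (intro Ck_norm_Suc_eq) (auto intro!: derivative_eq_intros f')
      also have "\<dots> \<le> 3 * Ck_norm 0 f + 2^k * (C + 1) * Ck_norm k f'"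
        using 1 2 by linarith
      also have "\<dots> \<le> D * Ck_norm 0 f + D * Ck_norm k f'"
        unfolding D_def using nn C(1) by (intro add_mono mult_right_mono) auto
      finally show ?thesis
        by (simp add: Ck_norm_Suc_eq[OF f'(2)] distrib_left)
    qed
    moreover have "D \<ge> 0" using C(1) by (simp add: D_def)
    ultimately show ?case by blast
  qed
  then show thesis using that by blast
qed

subsection \<open>Gradients under the change of variables\<close>

lemma C_map_eq:
  "C_map \<alpha> (z, g) = (z, \<lambda>\<theta>. g \<theta> + \<alpha> / 4 * mean_free_primitive (\<lambda>s. exp (2 * z s)) \<theta>)"
  by (simp add: C_map_def mean_free_primitive_def)

text \<open>The correction of the second component depends only on the first, which the shear leaves
  fixed, so the two corrections cancel.\<close>

lemma C_map_inverse: "C_map (- \<alpha>) (C_map \<alpha> x) = x"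
  by (cases x) (simp add: C_map_eq)

lemma circle_Ck_exp_minus_1: "f \<in> circle_Ck k \<Longrightarrow> (\<lambda>x. exp (f x) - 1) \<in> circle_Ck k"
  using circle_Ck_add[OF circle_Ck_exp circle_Ck_const[of "-1"]] by simp

text \<open>For \<open>E\<close> = e^(2u) the argument of A is the increment e^(2(u+h)) - e^(2u).
  The shear thus sends small perturbations to small ones, with linear control. The hypothesis on h
  keeps 2h in the unit ball of \<open>Ck_norm_exp_minus_1\<close>.\<close>

lemma C_map_increment_bound:
  assumes E: "E \<in> circle_Ck k"
  obtains B where "0 \<le> B"
    "\<And>h. h \<in> circle_Ck k \<Longrightarrow> 2 ^ Suc k * Ck_norm k h \<le> 1 \<Longrightarrow>
      Ck_norm k (\<lambda>\<theta>. c * mean_free_primitive (\<lambda>s. E s * (exp (2 * h s) - 1)) \<theta>) \<le> B * Ck_norm k h"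
proof -
  obtain C where C: "0 \<le> C"
    "\<And>f. f \<in> circle_Ck k \<Longrightarrow> Ck_norm k f \<le> 1 \<Longrightarrow> Ck_norm k (\<lambda>x. exp (f x) - 1) \<le> C * Ck_norm k f"
    using Ck_norm_exp_minus_1 by blast
  \<comment> \<open>From the outside in, the factors come from scaling by \<open>c\<close>, from A,
    from multiplication by \<open>E\<close>, from the exponential, and from the factor 2 in
    2h.\<close>
  define B where
    "B = 2^k * (\<bar>c\<bar> * ((8 * pi + 2) * (2^k * (Ck_norm k E * (C * 2 ^ Suc k)))))"
  have nE: "0 \<le> Ck_norm k E" using E by (rule Ck_norm_nonneg)
  show thesis
  proof
    show "0 \<le> B" unfolding B_def using C(1) nE by (intro mult_nonneg_nonneg) auto
    fix h assume h: "h \<in> circle_Ck k" "2 ^ Suc k * Ck_norm k h \<le> 1"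
    have h2: "(\<lambda>s. 2 * h s) \<in> circle_Ck k" by (rule circle_Ck_scale[OF h(1)])
    have n2: "Ck_norm k (\<lambda>s. 2 * h s) \<le> 2 ^ Suc k * Ck_norm k h"
      using Ck_norm_scale[OF h(1), of 2] by (simp add: mult_ac)
    have Dk: "(\<lambda>s. E s * (exp (2 * h s) - 1)) \<in> circle_Ck k"
      by (intro circle_Ck_mult E circle_Ck_exp_minus_1 h2)
    have "Ck_norm k (\<lambda>s. exp (2 * h s) - 1) \<le> C * (2 ^ Suc k * Ck_norm k h)"
      using C(2)[OF h2] n2 h(2) C(1) by (meson mult_left_mono order_trans)
    then have "Ck_norm k (\<lambda>s. E s * (exp (2 * h s) - 1))
        \<le> 2^k * (Ck_norm k E * (C * (2 ^ Suc k * Ck_norm k h)))"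
      using nE by (intro order_trans[OF Ck_norm_mult[OF E circle_Ck_exp_minus_1[OF h2]]] mult_left_mono) auto
    then have "Ck_norm k (mean_free_primitive (\<lambda>s. E s * (exp (2 * h s) - 1)))
        \<le> (8 * pi + 2) * (2^k * (Ck_norm k E * (C * (2 ^ Suc k * Ck_norm k h))))"
      by (intro order_trans[OF Ck_norm_mean_free_primitive[OF Dk]] mult_left_mono) auto
    then have "Ck_norm k (\<lambda>\<theta>. c * mean_free_primitive (\<lambda>s. E s * (exp (2 * h s) - 1)) \<theta>)
        \<le> 2^k * (\<bar>c\<bar> * ((8 * pi + 2) * (2^k * (Ck_norm k E * (C * (2 ^ Suc k * Ck_norm k h))))))"
      by (intro order_trans[OF Ck_norm_scale[OF circle_Ck_mean_free_primitive[OF Dk]]] mult_left_mono) auto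
    then show "Ck_norm k (\<lambda>\<theta>. c * mean_free_primitive (\<lambda>s. E s * (exp (2 * h s) - 1)) \<theta>)
        \<le> B * Ck_norm k h"
      unfolding B_def by (simp only: mult_ac)
  qed
qed

text \<open>The part of the increment beyond first order is quadratic in h. Only an integral of it
  is estimated, so the supremum norm suffices.\<close>

lemma C_map_remainder_bound:
  assumes E: "E \<in> circle_Ck 0" and g: "g \<in> circle_Ck 0"
  obtains K where "0 \<le> K"
    "\<And>h. h \<in> circle_Ck 0 \<Longrightarrow> 2 * Ck_norm 0 h \<le> 1 \<Longrightarrow>
      \<bar>circle_int (\<lambda>\<theta>. mean_free_primitive (\<lambda>s. E s * (exp (2 * h s) - 1 - 2 * h s)) \<theta> * g \<theta>)\<bar>
        \<le> K * (Ck_norm 0 h)\<^sup>2"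
proof
  \<comment> \<open>The inner 8 is the Taylor constant 2 times the square of the factor in 2h;
    \<open>8 * pi\<close> bounds A, and \<open>2 * pi\<close> is the length of the circle.\<close>
  let ?K = "8 * pi * (Ck_norm 0 E * 8) * Ck_norm 0 g * (2 * pi)"
  have nn: "0 \<le> Ck_norm 0 E" "0 \<le> Ck_norm 0 g" using E g by (auto intro: Ck_norm_nonneg)
  then show "0 \<le> ?K" by simp
  fix h assume h: "h \<in> circle_Ck 0" "2 * Ck_norm 0 h \<le> 1"
  let ?R = "\<lambda>s. E s * (exp (2 * h s) - 1 - 2 * h s)"
  have "(\<lambda>s. (exp (2 * h s) - 1) + (-2) * h s) \<in> circle_Ck 0"
    by (intro circle_Ck_add circle_Ck_exp_minus_1 circle_Ck_scale h)
  then have R: "?R \<in> circle_Ck 0" using circle_Ck_mult[OF E] by simp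
  have bound: "\<bar>?R s\<bar> \<le> Ck_norm 0 E * (8 * (Ck_norm 0 h)\<^sup>2)" for s
  proof -
    have hs: "\<bar>h s\<bar> \<le> Ck_norm 0 h" by (rule abs_le_Ck_norm[OF h(1)])
    then have "\<bar>exp (2 * h s) - 1 - 2 * h s\<bar> \<le> 2 * (2 * h s)\<^sup>2"
      using h(2) by (intro abs_exp_minus_linear_le) auto
    also have "\<dots> \<le> 8 * (Ck_norm 0 h)\<^sup>2"
      using power_mono[OF hs, of 2] by (simp add: power_mult_distrib)
    finally show ?thesis
      unfolding abs_mult by (intro mult_mono abs_le_Ck_norm E nn) auto
  qed
  have "\<bar>circle_int (\<lambda>\<theta>. mean_free_primitive ?R \<theta> * g \<theta>)\<bar>
      \<le> 8 * pi * (Ck_norm 0 E * (8 * (Ck_norm 0 h)\<^sup>2)) * Ck_norm 0 g * (2 * pi)"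
  proof (rule circle_int_bound)
    show "continuous_on UNIV (\<lambda>\<theta>. mean_free_primitive ?R \<theta> * g \<theta>)"
      by (rule circle_Ck_continuous[OF circle_Ck_mult[OF circle_Ck_mean_free_primitive[OF R] g]])
    fix x
    have "0 \<le> 8 * pi * (Ck_norm 0 E * (8 * (Ck_norm 0 h)\<^sup>2))" using nn by simp
    then show "\<bar>mean_free_primitive ?R x * g x\<bar>
        \<le> 8 * pi * (Ck_norm 0 E * (8 * (Ck_norm 0 h)\<^sup>2)) * Ck_norm 0 g"
      unfolding abs_mult by (intro mult_mono mean_free_primitive_bound R bound abs_le_Ck_norm g) auto
  qed
  then show "\<bar>circle_int (\<lambda>\<theta>. mean_free_primitive ?R \<theta> * g \<theta>)\<bar> \<le> ?K * (Ck_norm 0 h)\<^sup>2"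
    by (simp only: mult_ac)
qed

text \<open>A perturbation h of u changes the second argument of \<open>F\<close> by \<alpha>/4 A
  applied to the increment of e^(2u). Its linear part is tested against the second gradient
  component, and antisymmetry moves A there, which yields the correction of the first
  component.\<close>

lemma has_L2_gradient_compose_C_map:
  assumes u: "u \<in> circle_Ck k"
    and grad: "has_L2_gradient k F (C_map \<alpha> (u, v)) (g\<^sub>1, g\<^sub>2)"
  shows "has_L2_gradient k (F \<circ> C_map \<alpha>) (u, v)
    (\<lambda>\<theta>. g\<^sub>1 \<theta> - \<alpha> / 2 * (exp (2 * u \<theta>) * mean_free_primitive g\<^sub>2 \<theta>), g\<^sub>2)"
proof -
  let ?A = mean_free_primitive
  define E where "E = (\<lambda>s. exp (2 * u s))"
  define V where "V = (\<lambda>\<theta>. v \<theta> + \<alpha> / 4 * ?A E \<theta>)"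
  define G where "G = (\<lambda>\<theta>. g\<^sub>1 \<theta> - \<alpha> / 2 * (E \<theta> * ?A g\<^sub>2 \<theta>))"
  have C: "C_map \<alpha> (u, v) = (u, V)" by (simp add: C_map_eq V_def E_def)
  have g: "g\<^sub>1 \<in> circle_Ck 0" "g\<^sub>2 \<in> circle_Ck 0"
    using grad by (auto simp: has_L2_gradient_def C)
  have E: "E \<in> circle_Ck k" unfolding E_def by (intro circle_Ck_exp circle_Ck_scale u)
  then have E0: "E \<in> circle_Ck 0" using circle_Ck_antimono[of 0 k] by auto
  have "(\<lambda>\<theta>. g\<^sub>1 \<theta> + (-\<alpha> / 2) * (E \<theta> * ?A g\<^sub>2 \<theta>)) \<in> circle_Ck 0"
    by (intro circle_Ck_add circle_Ck_scale circle_Ck_mult circle_Ck_mean_free_primitive g E0)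
  then have G: "G \<in> circle_Ck 0" by (simp add: G_def)
  \<comment> \<open>\<open>D h\<close> is the full increment of e^(2u), and \<open>R h\<close> is
    what remains after its linear part \<open>2 * E * h\<close>.\<close>
  define D where "D = (\<lambda>h s. E s * (exp (2 * h s) - 1))"
  define R where "R = (\<lambda>h s. E s * (exp (2 * h s) - 1 - 2 * h s))"
  obtain B where B: "0 \<le> B"
    "\<And>h. h \<in> circle_Ck k \<Longrightarrow> 2 ^ Suc k * Ck_norm k h \<le> 1 \<Longrightarrow>
      Ck_norm k (\<lambda>\<theta>. \<alpha> / 4 * ?A (D h) \<theta>) \<le> B * Ck_norm k h"
    unfolding D_def using C_map_increment_bound[OF E, of "\<alpha> / 4"] by blast
  obtain K where K: "0 \<le> K"
    "\<And>h. h \<in> circle_Ck 0 \<Longrightarrow> 2 * Ck_norm 0 h \<le> 1 \<Longrightarrow>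
      \<bar>circle_int (\<lambda>\<theta>. ?A (R h) \<theta> * g\<^sub>2 \<theta>)\<bar> \<le> K * (Ck_norm 0 h)\<^sup>2"
    unfolding R_def using C_map_remainder_bound[OF E0 g(2)] by blast
  have "\<exists>\<delta>>0. \<forall>h\<in>circle_Ck k. \<forall>w\<in>circle_Ck k. Ck_norm k h + Ck_norm k w < \<delta> \<longrightarrow>
      \<bar>(F \<circ> C_map \<alpha>) (\<lambda>\<theta>. u \<theta> + h \<theta>, \<lambda>\<theta>. v \<theta> + w \<theta>) - (F \<circ> C_map \<alpha>) (u, v)
         - circle_int (\<lambda>\<theta>. G \<theta> * h \<theta> + g\<^sub>2 \<theta> * w \<theta>)\<bar>
      \<le> \<epsilon> * (Ck_norm k h + Ck_norm k w)" if eps: "\<epsilon> > 0" for \<epsilon>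
  proof -
    define K' where "K' = \<bar>\<alpha> / 4\<bar> * K"
    have K': "0 \<le> K'" using K(1) by (simp add: K'_def)
    \<comment> \<open>Half of the tolerance goes to the expansion of \<open>F\<close>, where the
      perturbation grows by at most the factor \<open>1 + B\<close>; the other half goes to the
      quadratic remainder.\<close>
    define \<epsilon>' where "\<epsilon>' = \<epsilon> / (2 * (1 + B))"
    have eps': "\<epsilon>' > 0" using eps B(1) by (simp add: \<epsilon>'_def)
    then obtain \<delta>' where d': "\<delta>' > 0"
      "\<And>h w. h \<in> circle_Ck k \<Longrightarrow> w \<in> circle_Ck k \<Longrightarrow> Ck_norm k h + Ck_norm k w < \<delta>' \<Longrightarrow>
        \<bar>F (\<lambda>\<theta>. u \<theta> + h \<theta>, \<lambda>\<theta>. V \<theta> + w \<theta>) - F (u, V)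
           - circle_int (\<lambda>\<theta>. g\<^sub>1 \<theta> * h \<theta> + g\<^sub>2 \<theta> * w \<theta>)\<bar> \<le> \<epsilon>' * (Ck_norm k h + Ck_norm k w)"
      using grad unfolding has_L2_gradient_def C by auto
    \<comment> \<open>In order: the sheared perturbation stays within \<open>\<delta>'\<close>, the
      bounds on the increment and the remainder apply, and the quadratic term is at most half the
      tolerance times the norm. Adding 1 to \<open>K'\<close> avoids a zero denominator.\<close>
    define \<delta> where "\<delta> = min (\<delta>' / (1 + B)) (min (1 / 2 ^ Suc k) (\<epsilon> / (2 * (K' + 1))))"
    show ?thesis
    proof (intro exI[of _ \<delta>] conjI ballI impI)
      show "\<delta> > 0" using d' B(1) K' eps by (simp add: \<delta>_def)
      fix h w assume h: "h \<in> circle_Ck k" and w: "w \<in> circle_Ck k"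
        and small: "Ck_norm k h + Ck_norm k w < \<delta>"
      define n where "n = Ck_norm k h + Ck_norm k w"
      have nn: "0 \<le> Ck_norm k h" "0 \<le> Ck_norm k w" using h w by (auto intro: Ck_norm_nonneg)
      then have n: "0 \<le> n" "Ck_norm k h \<le> n" by (auto simp: n_def)
      have "n < \<delta>' / (1 + B)" "n < 1 / 2 ^ Suc k" "n < \<epsilon> / (2 * (K' + 1))"
        using small by (auto simp: n_def \<delta>_def)
      then have sm: "(1 + B) * n < \<delta>'" "2 ^ Suc k * n < 1" "(K' + 1) * n < \<epsilon> / 2"
        using B(1) K' by (simp_all add: pos_less_divide_eq mult.commute mult.left_commute)
      have "2 ^ Suc k * Ck_norm k h \<le> 2 ^ Suc k * n"
        using n(2) by (intro mult_left_mono) auto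
      with sm(2) have small_h: "2 ^ Suc k * Ck_norm k h \<le> 1" by linarith
      define w' where "w' = (\<lambda>\<theta>. w \<theta> + \<alpha> / 4 * ?A (D h) \<theta>)"
      have h0: "h \<in> circle_Ck 0" "w \<in> circle_Ck 0" using h w circle_Ck_antimono[of 0 k] by auto
      have h2: "(\<lambda>s. 2 * h s) \<in> circle_Ck k" by (rule circle_Ck_scale[OF h])
      have D: "D h \<in> circle_Ck k" unfolding D_def by (intro circle_Ck_mult E circle_Ck_exp_minus_1 h2)
      have w': "w' \<in> circle_Ck k" unfolding w'_def
        by (intro circle_Ck_add w circle_Ck_scale circle_Ck_mean_free_primitive D)
      have "Ck_norm k w' \<le> Ck_norm k w + B * Ck_norm k h"
        unfolding w'_def
        using Ck_norm_add[OF w circle_Ck_scale[OF circle_Ck_mean_free_primitive[OF D]], of "\<alpha> / 4"]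
          B(2)[OF h small_h] by linarith
      moreover have "B * Ck_norm k h \<le> B * n" using n(2) B(1) by (rule mult_left_mono)
      ultimately have nw': "Ck_norm k h + Ck_norm k w' \<le> (1 + B) * n"
        by (simp add: n_def distrib_right)
      have main: "\<bar>F (\<lambda>\<theta>. u \<theta> + h \<theta>, \<lambda>\<theta>. V \<theta> + w' \<theta>) - F (u, V)
           - circle_int (\<lambda>\<theta>. g\<^sub>1 \<theta> * h \<theta> + g\<^sub>2 \<theta> * w' \<theta>)\<bar> \<le> \<epsilon> / 2 * n"
      proof -
        have "Ck_norm k h + Ck_norm k w' < \<delta>'" using nw' sm(1) by linarith
        note d'(2)[OF h w' this]
        also have "\<epsilon>' * (Ck_norm k h + Ck_norm k w') \<le> \<epsilon>' * ((1 + B) * n)"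
          using nw' eps' by (intro mult_left_mono) auto
        also have "\<dots> = \<epsilon> / 2 * n" using B(1) by (simp add: \<epsilon>'_def field_simps)
        finally show ?thesis .
      qed
      note c = circle_Ck_continuous[OF g(1)] circle_Ck_continuous[OF g(2)]
        circle_Ck_continuous[OF E0] circle_Ck_continuous[OF h] circle_Ck_continuous[OF w]
      have cR: "continuous_on UNIV (R h)" "continuous_on UNIV (D h)"
        unfolding R_def D_def by (intro continuous_intros c)+
      define L where "L = (\<lambda>s. E s * (2 * h s))"
      have L: "L \<in> circle_Ck 0" unfolding L_def by (intro circle_Ck_mult circle_Ck_scale E0 h0)
      note cL = circle_Ck_continuous[OF L]
      \<comment> \<open>The coefficients 1 match the form of the linearity rule. Linearity of A
        shows that perturbing by \<open>h\<close>, \<open>w\<close> before the shear amounts to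
        perturbing by \<open>h\<close>, \<open>w'\<close> after it.\<close>
      have "(\<lambda>s. exp (2 * (u s + h s))) = (\<lambda>s. 1 * E s + 1 * D h s)"
        by (simp add: E_def D_def fun_eq_iff algebra_simps flip: exp_add)
      then have "?A (\<lambda>s. exp (2 * (u s + h s))) = (\<lambda>\<theta>. ?A E \<theta> + ?A (D h) \<theta>)"
        by (simp only: mean_free_primitive_linear[OF c(3) cR(2)]) simp
      then have shift: "C_map \<alpha> (\<lambda>\<theta>. u \<theta> + h \<theta>, \<lambda>\<theta>. v \<theta> + w \<theta>) =
          (\<lambda>\<theta>. u \<theta> + h \<theta>, \<lambda>\<theta>. V \<theta> + w' \<theta>)"
        by (simp add: C_map_eq V_def w'_def fun_eq_iff algebra_simps)
      have "D h = (\<lambda>s. 1 * L s + 1 * R h s)"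
        by (simp add: D_def L_def R_def fun_eq_iff algebra_simps)
      then have AD: "?A (D h) = (\<lambda>\<theta>. ?A L \<theta> + ?A (R h) \<theta>)"
        by (simp only: mean_free_primitive_linear[OF cL cR(1)]) simp
      define I1 where "I1 = circle_int (\<lambda>\<theta>. g\<^sub>1 \<theta> * h \<theta> + g\<^sub>2 \<theta> * w \<theta>)"
      define I2 where "I2 = circle_int (\<lambda>\<theta>. ?A L \<theta> * g\<^sub>2 \<theta>)"
      define I3 where "I3 = circle_int (\<lambda>\<theta>. ?A (R h) \<theta> * g\<^sub>2 \<theta>)"
      have "circle_int (\<lambda>\<theta>. g\<^sub>1 \<theta> * h \<theta> + g\<^sub>2 \<theta> * w' \<theta>) =
          circle_int (\<lambda>\<theta>. 1 * (g\<^sub>1 \<theta> * h \<theta> + g\<^sub>2 \<theta> * w \<theta>)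
            + \<alpha> / 4 * (1 * (?A L \<theta> * g\<^sub>2 \<theta>) + 1 * (?A (R h) \<theta> * g\<^sub>2 \<theta>)))"
        by (simp add: w'_def AD algebra_simps)
      also have "\<dots> = 1 * I1 + \<alpha> / 4 * (1 * I2 + 1 * I3)"
        unfolding I1_def I2_def I3_def
        by (subst circle_int_linear, intro continuous_intros c cL cR, intro continuous_intros c cL cR,
            subst circle_int_linear, intro continuous_intros c cL cR, intro continuous_intros c cL cR)
           (rule refl)
      finally have i1: "circle_int (\<lambda>\<theta>. g\<^sub>1 \<theta> * h \<theta> + g\<^sub>2 \<theta> * w' \<theta>) = I1 + \<alpha> / 4 * (I2 + I3)"
        by simp
      have "circle_int (\<lambda>\<theta>. G \<theta> * h \<theta> + g\<^sub>2 \<theta> * w \<theta>) =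
          circle_int (\<lambda>\<theta>. 1 * (g\<^sub>1 \<theta> * h \<theta> + g\<^sub>2 \<theta> * w \<theta>) + (-\<alpha> / 4) * (L \<theta> * ?A g\<^sub>2 \<theta>))"
        by (simp add: G_def L_def algebra_simps)
      also have "\<dots> = 1 * I1 + (-\<alpha> / 4) * circle_int (\<lambda>\<theta>. L \<theta> * ?A g\<^sub>2 \<theta>)"
        unfolding I1_def by (intro circle_int_linear continuous_intros c cL)
      \<comment> \<open>This sign makes the correction in \<open>G\<close> reproduce the linear
        term, so the two pairings differ by \<open>\<alpha> / 4 * I3\<close> alone.\<close>
      also have "circle_int (\<lambda>\<theta>. L \<theta> * ?A g\<^sub>2 \<theta>) = - I2"
        unfolding I2_def using circle_int_antisymmetric[OF L g(2)] by simp
      finally have i2: "circle_int (\<lambda>\<theta>. G \<theta> * h \<theta> + g\<^sub>2 \<theta> * w \<theta>) = I1 + \<alpha> / 4 * I2" by simp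
      have "\<bar>\<alpha> / 4 * I3\<bar> \<le> \<epsilon> / 2 * n"
      proof -
        have h0n: "Ck_norm 0 h \<le> n" "0 \<le> Ck_norm 0 h"
          using Ck_norm_0_le_Ck_norm[OF h] n(2) Ck_norm_nonneg[OF h0(1)] by auto
        have "1 * Ck_norm 0 h \<le> 2 ^ k * Ck_norm k h"
          using Ck_norm_0_le_Ck_norm[OF h] h0n by (intro mult_mono) auto
        then have "2 * Ck_norm 0 h \<le> 1" using small_h by simp
        from K(2)[OF h0(1) this] have "\<bar>I3\<bar> \<le> K * (Ck_norm 0 h)\<^sup>2"
          by (simp add: I3_def)
        also have "\<dots> \<le> K * n\<^sup>2" using h0n K(1) by (intro mult_left_mono power_mono) auto
        finally have "\<bar>\<alpha> / 4 * I3\<bar> \<le> K' * n\<^sup>2"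
          unfolding K'_def abs_mult[of "\<alpha> / 4"] by (simp add: mult_left_mono mult.assoc)
        also have "\<dots> \<le> ((K' + 1) * n) * n"
          using n(1) by (simp add: power2_eq_square algebra_simps)
        also have "\<dots> \<le> \<epsilon> / 2 * n" using sm(3) n(1) by (intro mult_right_mono) auto
        finally show ?thesis .
      qed
      then have "\<bar>F (\<lambda>\<theta>. u \<theta> + h \<theta>, \<lambda>\<theta>. V \<theta> + w' \<theta>) - F (u, V)
           - circle_int (\<lambda>\<theta>. G \<theta> * h \<theta> + g\<^sub>2 \<theta> * w \<theta>)\<bar> \<le> \<epsilon> * n"
        using main unfolding i1 i2 by (simp only: distrib_left abs_le_iff) linarith
      then show "\<bar>(F \<circ> C_map \<alpha>) (\<lambda>\<theta>. u \<theta> + h \<theta>, \<lambda>\<theta>. v \<theta> + w \<theta>) - (F \<circ> C_map \<alpha>) (u, v)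
           - circle_int (\<lambda>\<theta>. G \<theta> * h \<theta> + g\<^sub>2 \<theta> * w \<theta>)\<bar>
        \<le> \<epsilon> * (Ck_norm k h + Ck_norm k w)"
        by (simp add: shift C n_def)
    qed
  qed
  then show ?thesis
    unfolding has_L2_gradient_def using G g(2) by (simp add: G_def E_def)
qed

subsection \<open>Time-dependent families\<close>

text \<open>Joint continuity is asked of the time derivative, as in
  \<open>classical_solution\<close>; that of the family itself is derived in
  \<open>C1_family_jointly_continuous\<close>.\<close>

definition C1_family :: "real set \<Rightarrow> (real \<Rightarrow> real \<Rightarrow> real) \<Rightarrow> (real \<Rightarrow> real \<Rightarrow> real) \<Rightarrow> bool" where
  "C1_family T f f' \<longleftrightarrow> (\<forall>t\<in>T. continuous_on UNIV (f t)) \<and>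
     continuous_on (T \<times> UNIV) (\<lambda>(t, \<theta>). f' t \<theta>) \<and>
     (\<forall>t\<in>T. \<forall>\<theta>. ((\<lambda>s. f s \<theta>) has_real_derivative f' t \<theta>) (at t within T))"

lemma jointly_continuous_slice:
  assumes "continuous_on (T \<times> UNIV) (\<lambda>(t, \<theta>). f t \<theta>)" "t \<in> T"
  shows "continuous_on UNIV (f t)"
proof -
  have "continuous_on UNIV ((\<lambda>(t, \<theta>). f t \<theta>) \<circ> Pair t)"
    by (rule continuous_on_compose)
      (auto intro!: continuous_intros continuous_on_subset[OF assms(1)] assms(2))
  then show ?thesis by (simp add: o_def)
qed

text \<open>A fixed interval of integration makes parameter-dependent primitives accessible to the
  theorems on continuity and differentiation under the integral sign.\<close>

lemma primitive_rescaled: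
  assumes "continuous_on UNIV f"
  shows "primitive f \<theta> = \<theta> * integral {0..1} (\<lambda>s. f (\<theta> * s))"
proof -
  have "((\<lambda>s. \<theta> * f (\<theta> * s)) has_integral primitive f (\<theta> * 1) - primitive f (\<theta> * 0)) {0..1}"
  proof (rule fundamental_theorem_of_calculus)
    fix s :: real
    have "((\<lambda>s. primitive f (\<theta> * s)) has_real_derivative f (\<theta> * s) * \<theta>) (at s within {0..1})"
      by (rule DERIV_chain2[of "primitive f"])
        (auto intro!: derivative_eq_intros primitive_has_derivative assms)
    then show "((\<lambda>s. primitive f (\<theta> * s)) has_vector_derivative \<theta> * f (\<theta> * s)) (at s within {0..1})"
      by (simp add: has_real_derivative_iff_has_vector_derivative mult.commute)
  qed simp
  from integral_unique[OF this] show ?thesis by simp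
qed

text \<open>Differentiation under the integral sign over the unit interval; \<open>T\<close> enters
  through its convexity.\<close>

lemma C1_family_primitive:
  assumes T: "is_interval T" and fam: "C1_family T f f'"
  shows "C1_family T (\<lambda>t. primitive (f t)) (\<lambda>t. primitive (f' t))"
proof -
  have c: "\<And>t. t \<in> T \<Longrightarrow> continuous_on UNIV (f t)"
    and c': "continuous_on (T \<times> UNIV) (\<lambda>(t, \<theta>). f' t \<theta>)"
    and d: "\<And>t \<theta>. t \<in> T \<Longrightarrow> ((\<lambda>s. f s \<theta>) has_real_derivative f' t \<theta>) (at t within T)"
    using fam by (auto simp: C1_family_def)
  note slice = jointly_continuous_slice[OF c']
  have "continuous_on (T \<times> UNIV) (\<lambda>p. snd p * integral (cbox 0 1) (\<lambda>s. f' (fst p) (snd p * s)))"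
  proof (intro continuous_intros integral_continuous_on_param)
    have "continuous_on ((T \<times> UNIV) \<times> cbox 0 1)
        ((\<lambda>(t, \<theta>). f' t \<theta>) \<circ> (\<lambda>q. (fst (fst q), snd (fst q) * snd q)))"
      by (rule continuous_on_compose) (auto intro!: continuous_intros continuous_on_subset[OF c'])
    then show "continuous_on ((T \<times> UNIV) \<times> cbox 0 1) (\<lambda>(p, s). f' (fst p) (snd p * s))"
      by (simp add: o_def case_prod_beta)
  qed
  then have 1: "continuous_on (T \<times> UNIV) (\<lambda>(t, \<theta>). primitive (f' t) \<theta>)"
    by (rule continuous_on_eq) (auto simp: primitive_rescaled slice)
  have 2: "((\<lambda>s. primitive (f s) \<theta>) has_real_derivative primitive (f' t) \<theta>) (at t within T)"
    if t: "t \<in> T" for t \<theta>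
  proof -
    have "((\<lambda>t. integral (cbox 0 1) (\<lambda>s. f t (\<theta> * s))) has_field_derivative
        integral (cbox 0 1) (\<lambda>s. f' t (\<theta> * s))) (at t within T)"
    proof (rule leibniz_rule_field_derivative)
      show "convex T" using T by (simp add: is_interval_convex_1)
      have "continuous_on (T \<times> cbox 0 1) ((\<lambda>(t, \<theta>). f' t \<theta>) \<circ> (\<lambda>q. (fst q, \<theta> * snd q)))"
        by (rule continuous_on_compose) (auto intro!: continuous_intros continuous_on_subset[OF c'])
      then show "continuous_on (T \<times> cbox 0 1) (\<lambda>(t, s). f' t (\<theta> * s))"
        by (simp add: o_def case_prod_beta)
      show "(\<lambda>s. f t (\<theta> * s)) integrable_on cbox 0 1" if "t \<in> T" for t
        by (intro integrable_continuous continuous_on_compose2[OF c[OF that]] continuous_intros) auto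
    qed (use d t in auto)
    from DERIV_cmult[OF this, of \<theta>]
    have "((\<lambda>t. \<theta> * integral {0..1} (\<lambda>s. f t (\<theta> * s))) has_field_derivative primitive (f' t) \<theta>)
        (at t within T)"
      by (simp add: primitive_rescaled[OF slice[OF t]])
    then show ?thesis
      by (rule has_field_derivative_transform_within[OF _ zero_less_one t]) (simp add: primitive_rescaled c)
  qed
  show ?thesis using 1 2 c by (auto simp: C1_family_def intro: continuous_on_primitive)
qed

text \<open>The average is the primitive at the fixed point \<open>2*pi\<close>, up to a factor, so
  the preceding result covers it.\<close>

lemma C1_family_Pi0_perp:
  assumes T: "is_interval T" and fam: "C1_family T f f'"
  shows "C1_family T (\<lambda>t. Pi0_perp (f t)) (\<lambda>t. Pi0_perp (f' t))"
proof -
  note p = C1_family_primitive[OF T fam, unfolded C1_family_def]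
  note f = fam[unfolded C1_family_def]
  have "continuous_on (T \<times> UNIV) ((\<lambda>(t, \<theta>). primitive (f' t) \<theta>) \<circ> (\<lambda>q. (fst q, 2*pi)))"
    by (rule continuous_on_compose)
      (auto intro!: continuous_intros continuous_on_subset[OF conjunct1[OF conjunct2[OF p]]])
  then have "continuous_on (T \<times> UNIV) (\<lambda>(t, \<theta>::real). primitive (f' t) (2*pi))"
    by (simp add: o_def case_prod_beta)
  then have "continuous_on (T \<times> UNIV) (\<lambda>q. (\<lambda>(t, \<theta>). f' t \<theta>) q
      - (\<lambda>(t, \<theta>). primitive (f' t) (2*pi)) q / (2*pi))"
    using f by (intro continuous_intros) auto
  then have "continuous_on (T \<times> UNIV) (\<lambda>(t, \<theta>). Pi0_perp (f' t) \<theta>)"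
    by (simp add: Pi0_perp_def circle_int_eq_primitive case_prod_beta)
  moreover have "((\<lambda>s. Pi0_perp (f s) \<theta>) has_real_derivative Pi0_perp (f' t) \<theta>) (at t within T)"
    if "t \<in> T" for t \<theta>
    using p f that unfolding Pi0_perp_def circle_int_eq_primitive
    by (intro DERIV_diff DERIV_cdivide) auto
  ultimately show ?thesis using f by (auto simp: C1_family_def intro: continuous_on_Pi0_perp)
qed

lemma C1_family_mean_free_primitive:
  assumes "is_interval T" "C1_family T f f'"
  shows "C1_family T (\<lambda>t. mean_free_primitive (f t)) (\<lambda>t. mean_free_primitive (f' t))"
  unfolding mean_free_primitive_eq
  by (intro C1_family_Pi0_perp C1_family_primitive assms)

text \<open>Near a point the time derivative is bounded by some \<open>M\<close>, so the mean value
  inequality controls the change in time uniformly in nearby \<theta>. The change in \<theta> is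
  taken at the fixed time \<open>t0\<close>, where the slice is continuous.\<close>

lemma C1_family_jointly_continuous:
  assumes T: "is_interval T" and fam: "C1_family T f f'"
  shows "continuous_on (T \<times> UNIV) (\<lambda>(t, \<theta>). f t \<theta>)"
  unfolding continuous_on_def
proof
  fix p :: "real \<times> real" assume "p \<in> T \<times> UNIV"
  then obtain t0 \<theta>0 where p: "p = (t0, \<theta>0)" "t0 \<in> T" by auto
  have c: "continuous_on UNIV (f t0)"
    and c': "continuous_on (T \<times> UNIV) (\<lambda>(t, \<theta>). f' t \<theta>)"
    and d: "\<And>t \<theta>. t \<in> T \<Longrightarrow> ((\<lambda>s. f s \<theta>) has_real_derivative f' t \<theta>) (at t within T)"
    using fam p by (auto simp: C1_family_def)
  define M where "M = \<bar>f' t0 \<theta>0\<bar> + 1"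
  obtain e where e: "e > 0" and
    near: "\<forall>q\<in>T \<times> UNIV. dist q p < e \<longrightarrow>
      dist ((\<lambda>(t, \<theta>). f' t \<theta>) q) ((\<lambda>(t, \<theta>). f' t \<theta>) p) < 1"
    using c' p \<open>p \<in> T \<times> UNIV\<close> unfolding continuous_on_iff by (meson zero_less_one)
  have M: "\<bar>f' t \<theta>\<bar> \<le> M" if "t \<in> T" "dist (t, \<theta>) (t0, \<theta>0) < e" for t \<theta>
  proof -
    have "\<bar>f' t \<theta> - f' t0 \<theta>0\<bar> < 1"
      using near[rule_format, of "(t, \<theta>)"] that by (simp add: p dist_real_def)
    then show ?thesis unfolding M_def by linarith
  qed
  \<comment> \<open>Halving the radius in each variable keeps the segment of times inside the ball
    where \<open>M\<close> is a bound.\<close>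
  have bound: "\<bar>f t \<theta> - f t0 \<theta>\<bar> \<le> M * \<bar>t - t0\<bar>"
    if "t \<in> T" "\<bar>t - t0\<bar> < e / 2" "\<bar>\<theta> - \<theta>0\<bar> < e / 2" for t \<theta>
  proof -
    let ?S = "T \<inter> ball t0 (e / 2)"
    have "norm (f t \<theta> - f t0 \<theta>) \<le> M * norm (t - t0)"
    proof (rule field_differentiable_bound[of ?S "\<lambda>s. f s \<theta>" "\<lambda>s. f' s \<theta>"])
      show "convex ?S" using T by (intro convex_Int convex_ball) (simp add: is_interval_convex_1)
      fix s assume s: "s \<in> ?S"
      show "((\<lambda>s. f s \<theta>) has_field_derivative f' s \<theta>) (at s within ?S)"
        using d[of s \<theta>] s by (auto intro: DERIV_subset)
      have "dist (s, \<theta>) (t0, \<theta>0) \<le> dist s t0 + dist \<theta> \<theta>0"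
        unfolding dist_Pair_Pair by (rule sqrt_sum_squares_le_sum) auto
      also have "\<dots> < e" using s that(3) by (simp add: dist_real_def abs_minus_commute)
      finally show "norm (f' s \<theta>) \<le> M" using M s by auto
    qed (use that e p in \<open>auto simp: dist_real_def abs_minus_commute\<close>)
    then show ?thesis by simp
  qed
  let ?F = "at p within T \<times> UNIV"
  have "((\<lambda>q. (\<lambda>(t, \<theta>). f t \<theta>) q - f t0 \<theta>0) \<longlongrightarrow> 0) ?F"
  proof (rule Lim_null_comparison)
    have "\<forall>\<^sub>F q in ?F. q \<in> T \<times> UNIV \<and> dist q p < e / 2"
      unfolding eventually_at using e by (intro exI[of _ "e / 2"]) auto
    then show "\<forall>\<^sub>F q in ?F. norm ((\<lambda>(t, \<theta>). f t \<theta>) q - f t0 \<theta>0)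
        \<le> M * \<bar>fst q - t0\<bar> + \<bar>f t0 (snd q) - f t0 \<theta>0\<bar>"
    proof eventually_elim
      case (elim q)
      have "dist (fst q) t0 < e / 2" "dist (snd q) \<theta>0 < e / 2"
        using elim dist_fst_le[of q p] dist_snd_le[of q p] by (auto simp: p)
      then show ?case using bound[of "fst q" "snd q"] elim
        by (auto simp: dist_real_def case_prod_beta)
    qed
    have "((\<lambda>q. M * \<bar>fst q - t0\<bar> + \<bar>f t0 (snd q) - f t0 \<theta>0\<bar>)
        \<longlongrightarrow> M * \<bar>fst p - t0\<bar> + \<bar>f t0 (snd p) - f t0 \<theta>0\<bar>) ?F"
      by (intro tendsto_intros continuous_on_tendsto_compose[OF c]) auto
    then show "((\<lambda>q. M * \<bar>fst q - t0\<bar> + \<bar>f t0 (snd q) - f t0 \<theta>0\<bar>) \<longlongrightarrow> 0) ?F"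
      by (simp add: p)
  qed
  then have "((\<lambda>(t, \<theta>). f t \<theta>) \<longlongrightarrow> f t0 \<theta>0) ?F"
    by (rule Lim_null[THEN iffD2])
  then show "((\<lambda>(t, \<theta>). f t \<theta>) \<longlongrightarrow> (\<lambda>(t, \<theta>). f t \<theta>) p) ?F"
    by (simp add: p)
qed

lemma C1_family_exp:
  assumes T: "is_interval T" and fam: "C1_family T f f'"
  shows "C1_family T (\<lambda>t \<theta>. exp (2 * f t \<theta>)) (\<lambda>t \<theta>. exp (2 * f t \<theta>) * (2 * f' t \<theta>))"
proof -
  have "continuous_on (T \<times> UNIV) (\<lambda>q. exp (2 * (\<lambda>(t, \<theta>). f t \<theta>) q) * (2 * (\<lambda>(t, \<theta>). f' t \<theta>) q))"
    using fam by (intro continuous_intros C1_family_jointly_continuous[OF T fam])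
      (auto simp: C1_family_def)
  then have "continuous_on (T \<times> UNIV) (\<lambda>(t, \<theta>). exp (2 * f t \<theta>) * (2 * f' t \<theta>))"
    by (simp add: case_prod_beta)
  moreover have "((\<lambda>s. exp (2 * f s \<theta>)) has_real_derivative exp (2 * f t \<theta>) * (2 * f' t \<theta>)) (at t within T)"
    if "t \<in> T" for t \<theta>
    using fam that by (intro DERIV_chain2[OF DERIV_exp] DERIV_cmult) (auto simp: C1_family_def)
  moreover have "continuous_on UNIV (\<lambda>\<theta>. exp (2 * f t \<theta>))" if "t \<in> T" for t
    using fam that by (intro continuous_intros) (auto simp: C1_family_def)
  ultimately show ?thesis by (simp add: C1_family_def)
qed

section \<open>Transport of solutions by the shear, and the equivalence of the two systems\<close>

lemma J_alpha_eq:
  "J_alpha \<alpha> \<xi> (g\<^sub>1, g\<^sub>2) = (\<lambda>\<theta>. exp (- 2 * \<xi> \<theta>) * g\<^sub>2 \<theta>,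
    \<lambda>\<theta>. - exp (- 2 * \<xi> \<theta>) * g\<^sub>1 \<theta> + \<alpha> * mean_free_primitive g\<^sub>2 \<theta>)"
  by (simp add: J_alpha_def mean_free_primitive_def)

lemma J_alpha_0: "J_alpha 0 = J_can"
  by (auto simp: J_alpha_def J_can_def fun_eq_iff)

text \<open>Composing the functional with the inverse shear keeps its value along the moved
  solution. With both parameters free, each direction of the equivalence is an instance.\<close>

lemma classical_solution_C_map:
  assumes T: "is_interval T" and sol: "classical_solution k T (J_alpha \<beta>) F x"
  shows "classical_solution k T (J_alpha (\<beta> + \<alpha>)) (F \<circ> C_map (- \<alpha>)) (\<lambda>t. C_map \<alpha> (x t))"
proof -
  let ?A = mean_free_primitive
  define z v where "z = (\<lambda>t. fst (x t))" and "v = (\<lambda>t. snd (x t))"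
  have x: "x t = (z t, v t)" for t by (simp add: z_def v_def)
  have zk: "\<And>t. t \<in> T \<Longrightarrow> z t \<in> circle_Ck k" and vk: "\<And>t. t \<in> T \<Longrightarrow> v t \<in> circle_Ck k"
    using sol by (auto simp: classical_solution_def z_def v_def)
  obtain a b where a: "continuous_on (T \<times> UNIV) (\<lambda>(t, \<theta>). a t \<theta>)"
    "\<And>t \<theta>. t \<in> T \<Longrightarrow> ((\<lambda>s. z s \<theta>) has_real_derivative a t \<theta>) (at t within T)"
    and b: "continuous_on (T \<times> UNIV) (\<lambda>(t, \<theta>). b t \<theta>)"
    "\<And>t \<theta>. t \<in> T \<Longrightarrow> ((\<lambda>s. v s \<theta>) has_real_derivative b t \<theta>) (at t within T)"
    and eq: "\<And>t. t \<in> T \<Longrightarrow> \<exists>g. has_L2_gradient k F (z t, v t) g \<and> (a t, b t) = J_alpha \<beta> (z t) g"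
    using sol unfolding classical_solution_def x by auto
  \<comment> \<open>The time derivative of e^(2z), which passes through A because A acts in \<theta>
    only.\<close>
  define e where "e = (\<lambda>t \<theta>. exp (2 * z t \<theta>) * (2 * a t \<theta>))"
  have "C1_family T z a" using a zk by (auto simp: C1_family_def intro: circle_Ck_continuous)
  from C1_family_mean_free_primitive[OF T C1_family_exp[OF T this]]
  have fam: "C1_family T (\<lambda>t. ?A (\<lambda>\<theta>. exp (2 * z t \<theta>))) (\<lambda>t. ?A (e t))"
    by (simp add: e_def)
  define b' where "b' = (\<lambda>t \<theta>. b t \<theta> + \<alpha> / 4 * ?A (e t) \<theta>)"
  have "continuous_on (T \<times> UNIV) (\<lambda>q. (\<lambda>(t, \<theta>). b t \<theta>) q + \<alpha> / 4 * (\<lambda>(t, \<theta>). ?A (e t) \<theta>) q)"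
    using b fam by (intro continuous_intros) (auto simp: C1_family_def)
  then have 1: "continuous_on (T \<times> UNIV) (\<lambda>(t, \<theta>). b' t \<theta>)"
    by (simp add: b'_def case_prod_beta)
  have 2: "((\<lambda>s. v s \<theta> + \<alpha> / 4 * ?A (\<lambda>\<theta>. exp (2 * z s \<theta>)) \<theta>) has_real_derivative b' t \<theta>)
      (at t within T)" if "t \<in> T" for t \<theta>
    using b fam that unfolding b'_def C1_family_def
    by (intro DERIV_add DERIV_cmult) auto
  have 3: "\<exists>g. has_L2_gradient k (F \<circ> C_map (- \<alpha>)) (C_map \<alpha> (z t, v t)) g \<and>
      (a t, b' t) = J_alpha (\<beta> + \<alpha>) (z t) g" if t: "t \<in> T" for t
  proof -
    obtain g\<^sub>1 g\<^sub>2 where g: "has_L2_gradient k F (z t, v t) (g\<^sub>1, g\<^sub>2)"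
      and ab: "a t = (\<lambda>\<theta>. exp (- 2 * z t \<theta>) * g\<^sub>2 \<theta>)"
      "b t = (\<lambda>\<theta>. - exp (- 2 * z t \<theta>) * g\<^sub>1 \<theta> + \<beta> * ?A g\<^sub>2 \<theta>)"
      using eq[OF t] by (auto simp: J_alpha_eq)
    let ?g = "\<lambda>\<theta>. g\<^sub>1 \<theta> - (- \<alpha>) / 2 * (exp (2 * z t \<theta>) * ?A g\<^sub>2 \<theta>)"
    have "has_L2_gradient k (F \<circ> C_map (- \<alpha>)) (C_map \<alpha> (z t, v t)) (?g, g\<^sub>2)"
      \<comment> \<open>The chain rule is used at the sheared state, which the inverse shear returns
        to the original one, where the gradient of \<open>F\<close> is given.\<close>
      using has_L2_gradient_compose_C_map[OF zk[OF t], of F "- \<alpha>" _ g\<^sub>1 g\<^sub>2] g C_map_inverse[of \<alpha> "(z t, v t)"]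
      by (simp add: C_map_eq[of \<alpha>])
    moreover have "(a t, b' t) = J_alpha (\<beta> + \<alpha>) (z t) (?g, g\<^sub>2)"
    proof -
      have "continuous_on UNIV g\<^sub>2"
        using g by (auto simp: has_L2_gradient_def circle_Ck_0)
      moreover have inv: "exp (2 * z t \<theta>) * exp (- 2 * z t \<theta>) = 1" for \<theta>
        by (simp flip: exp_add)
      \<comment> \<open>The first equation of the system cancels the exponential weight; the zero
        summand fits the linearity rule.\<close>
      then have "e t = (\<lambda>\<theta>. 2 * g\<^sub>2 \<theta> + 0 * g\<^sub>2 \<theta>)"
        unfolding e_def ab(1) by (auto simp: fun_eq_iff mult.left_commute mult.assoc[symmetric])
      ultimately have "?A (e t) = (\<lambda>\<theta>. 2 * ?A g\<^sub>2 \<theta>)"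
        by (simp only: mean_free_primitive_linear) simp
      then have "b' t \<theta> = - exp (- 2 * z t \<theta>) * g\<^sub>1 \<theta> + (\<beta> + \<alpha> / 2) * ?A g\<^sub>2 \<theta>" for \<theta>
        by (simp add: b'_def ab(2) distrib_right)
      \<comment> \<open>The corrected gradient gives -\<alpha>/2, which together with the \<beta> +
        \<alpha> of the new structure leaves the coefficient \<beta> + \<alpha>/2 found
        above.\<close>
      moreover have "- exp (- 2 * z t \<theta>) * ?g \<theta> =
          - exp (- 2 * z t \<theta>) * g\<^sub>1 \<theta> - \<alpha> / 2 * ?A g\<^sub>2 \<theta>" for \<theta>
      proof -
        have "- X * (p - (- \<alpha>) / 2 * (Y * q)) = - X * p - \<alpha> / 2 * (Y * X * q)" for X Y p q :: real
          by (simp add: algebra_simps)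
        then show ?thesis by (simp only: inv mult_1)
      qed
      ultimately show ?thesis
        by (simp only: J_alpha_eq ab(1)) (simp add: fun_eq_iff distrib_right)
    qed
    ultimately show ?thesis by blast
  qed
  have "(\<lambda>\<theta>. v t \<theta> + \<alpha> / 4 * ?A (\<lambda>s. exp (2 * z t s)) \<theta>) \<in> circle_Ck k" if "t \<in> T" for t
    by (intro circle_Ck_add circle_Ck_scale circle_Ck_mean_free_primitive circle_Ck_exp zk vk that)
  then have "\<forall>t\<in>T. z t \<in> circle_Ck k \<and>
      (\<lambda>\<theta>. v t \<theta> + \<alpha> / 4 * ?A (\<lambda>s. exp (2 * z t s)) \<theta>) \<in> circle_Ck k"
    using zk by blast
  moreover have "\<forall>t\<in>T. \<forall>\<theta>. ((\<lambda>s. z s \<theta>) has_real_derivative a t \<theta>) (at t within T) \<and>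
      ((\<lambda>s. v s \<theta> + \<alpha> / 4 * ?A (\<lambda>\<theta>. exp (2 * z s \<theta>)) \<theta>) has_real_derivative b' t \<theta>)
        (at t within T)"
    using a(2) 2 by blast
  moreover have "\<forall>t\<in>T. \<exists>g. has_L2_gradient k (F \<circ> C_map (- \<alpha>)) (C_map \<alpha> (z t, v t)) g \<and>
      (a t, b' t) = J_alpha (\<beta> + \<alpha>) (z t) g"
    using 3 by blast
  ultimately show ?thesis
    unfolding classical_solution_def x C_map_eq fst_conv snd_conv using a(1) 1
    by - (rule conjI, assumption, rule exI[of _ a], rule exI[of _ b'], (intro conjI; assumption))
qed

theorem theorem3p7:
  fixes \<sigma>\<^sub>0 \<alpha>\<^sub>0 :: real and k :: nat and T :: "real set"
    and \<zeta> \<gamma> :: "real \<Rightarrow> real \<Rightarrow> real"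
  assumes "\<sigma>\<^sub>0 > 0" and "k \<ge> 2" and "is_interval T" and "interior T \<noteq> {}"
  shows "classical_solution k T (J_alpha \<alpha>\<^sub>0) (Ham \<sigma>\<^sub>0 \<alpha>\<^sub>0) (\<lambda>t. C_map \<alpha>\<^sub>0 (\<zeta> t, \<gamma> t))
     \<longleftrightarrow> classical_solution k T J_can (Ham \<sigma>\<^sub>0 \<alpha>\<^sub>0 \<circ> C_map \<alpha>\<^sub>0) (\<lambda>t. (\<zeta> t, \<gamma> t))"
proof
  assume "classical_solution k T (J_alpha \<alpha>\<^sub>0) (Ham \<sigma>\<^sub>0 \<alpha>\<^sub>0) (\<lambda>t. C_map \<alpha>\<^sub>0 (\<zeta> t, \<gamma> t))"
  \<comment> \<open>The opposite shear brings the parameter to zero, and \<open>J_alpha 0\<close> is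
    the canonical structure.\<close>
  from classical_solution_C_map[OF assms(3) this, of "- \<alpha>\<^sub>0"]
  show "classical_solution k T J_can (Ham \<sigma>\<^sub>0 \<alpha>\<^sub>0 \<circ> C_map \<alpha>\<^sub>0) (\<lambda>t. (\<zeta> t, \<gamma> t))"
    by (simp only: C_map_inverse J_alpha_0 add.right_inverse minus_minus)
next
  assume "classical_solution k T J_can (Ham \<sigma>\<^sub>0 \<alpha>\<^sub>0 \<circ> C_map \<alpha>\<^sub>0) (\<lambda>t. (\<zeta> t, \<gamma> t))"
  then have "classical_solution k T (J_alpha 0) (Ham \<sigma>\<^sub>0 \<alpha>\<^sub>0 \<circ> C_map \<alpha>\<^sub>0) (\<lambda>t. (\<zeta> t, \<gamma> t))"
    by (simp only: J_alpha_0)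
  from classical_solution_C_map[OF assms(3) this, of \<alpha>\<^sub>0]
  show "classical_solution k T (J_alpha \<alpha>\<^sub>0) (Ham \<sigma>\<^sub>0 \<alpha>\<^sub>0) (\<lambda>t. C_map \<alpha>\<^sub>0 (\<zeta> t, \<gamma> t))"
    \<comment> \<open>The two shears composed with the Hamiltonian cancel, so the original
      functional is left.\<close>
    using C_map_inverse[of "- \<alpha>\<^sub>0"] by (simp add: comp_def)
qed

end
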